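(* Let $\mathcal{T}$ be a self-affine tiling of $\mathbb{R}^d$ which is a fixed point of its substitution $\Omega$ (with expansive matrix $Q$). Assume that $\mathcal{T}$ is non-rod, that all of its tiles are connected (i.e. have connected supports), and that the set of return vectors $\Xi(\mathcal{T})$ is a Meyer set. Then there is a positive integer $n$, depending only on $\mathcal{T}$, such that $\mathcal{T}$ satisfies multiple strong coincidence of level $n$ if and only if $\mathcal{T}$ satisfies overlap coincidence.
   Context: **Tiles and tilings.** A tile in $\mathbb{R}^d$ is a pair $T=(A,i)$ where $A\subset\mathbb{R}^d$ is compact and equal to the closure of its interior, and $i=\ell(T)\in\{1,\dots,m\}$ is its color; $\operatorname{supp}(T)=A$ is its support, and $g+T=(g+A,i)$ for $g\in\mathbb{R}^d$. Let $\mathcal{A}=\{T_1,\dots,T_m\}$, $T_i=(A_i,i)$, be a finite set of prototiles. A tiling $\mathcal{T}$ is a collection of translates of prototiles covering $\mathbb{R}^d$ with pairwise disjoint interiors. A patch is a finite collection of tiles appearing in a tiling; a generalized patch of $\mathcal{T}$ is a (not necessarily finite) collection of tiles of $\mathcal{T}$. The support of a generalized patch is the union of the supports of its tiles, and topological or metrical properties (connected, unbounded, diameter) of a generalized patch refer to its support. **Substitution and self-affine tilings.** A substitution $\Omega$ with expansive $d\times d$ matrix $Q$ (all eigenvalues of modulus $>1$) is a map from $\mathcal{A}$ to patches given by finite sets $\mathcal{D}_{ij}\subset\mathbb{R}^d$ with $\Omega(T_j)=\{T_i+u : u\in\mathcal{D}_{ij},\ i=1,\dots,m\}$ and $QA_j=\bigcup_{i=1}^m\bigcup_{u\in\mathcal{D}_{ij}}(A_i+u)$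 for all $j\le m$, the sets in the last union having mutually disjoint interiors. It extends to translates by $\Omega(T_j+x)=\Omega(T_j)+Qx$ and to (generalized) patches and tilings tile by tile. A substitution tiling of $\Omega$ is a tiling $\mathcal{T}$ all of whose patches are, up to translation, sub-patches of $\Omega^k(T)$ for some $k\in\mathbb{N}$ and $T\in\mathcal{T}$. It is a fixed point of $\Omega$ if $\Omega(\mathcal{T})=\mathcal{T}$. The substitution is primitive if the matrix $(\sharp\mathcal{D}_{ij})$ is primitive. $\mathcal{T}$ has finite local complexity (FLC) if for each $R>0$ there are only finitely many patches of $\mathcal{T}$ of diameter less than $R$ up to translation. A self-affine tiling is an FLC substitution tiling of a primitive substitution. **Rods.** A rod is an unbounded connected generalized patch of $\mathcal{T}$ all of whose tiles have the same color. A rod tiling is a tiling every tile of which belongs to a rod; a non-rod tiling is a tiling that is not a rod tiling. **Return vectors, Meyer sets.** $\Xi(\mathcal{T})=\{y\in\mathbb{R}^d : U=V-y \text{ for some } U,V\in\mathcal{T}\}$. A set $\Lambda\subset\mathbb{R}^d$ is a Meyer set if it is Delone (relatively dense and uniformly discrete) and $\Lambda-\Lambda$ is uniformly discrete. **Overlap coincidence.** An overlap is a triple $(U,y,V)$ with $U,V\in\mathcal{T}$, $y\in\Xi(\mathcal{T})$ and $(\operatorname{supp}(U))^\circ\cap(\operatorname{supp}(V)-y)^\circ\ne\emptyset$. It is a coincidence if $U=V-y$. For an overlap $\mathcal{O}=(U,y,V)$ and $\ell\ge 1$ put $\Omega^\ell\mathcal{O}=\{(U',Q^\ell y,V') : U'\in\Omega^\ell(U),\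 V'\in\Omega^\ell(V),\ (U',Q^\ell y,V')\text{ is an overlap}\}$. $\mathcal{T}$ satisfies (admits) overlap coincidence if there exists $\ell\in\mathbb{Z}_{+}$ such that $\Omega^\ell\mathcal{O}$ contains a coincidence for every overlap $\mathcal{O}$ in $\mathcal{T}$. **Control points.** Let $n\ge1$; note $\Omega^n(\mathcal{T})=\mathcal{T}$ and $\Omega^n$ has expansive matrix $Q^n$. A tile map of $\Omega^n$ is a map $\gamma=\gamma_{\Omega^n}:\mathcal{T}\to\mathcal{T}$ sending each tile $T$ to a tile of $\Omega^n(T)$, such that $\gamma(T)$ and $\gamma(T')$ are in the same relative position in $\Omega^n(T)$ and $\Omega^n(T')$ whenever $\ell(T)=\ell(T')$ (i.e. if $T'=T+x$ then $\gamma(T')=\gamma(T)+Q^nx$). The control point $c(T)$ of $T\in\mathcal{T}$ (for $\Omega^n$ and $\gamma$) is the unique point of $\bigcap_{k=1}^\infty Q^{-nk}\operatorname{supp}(\gamma^k(T))$; tiles $T$ of the same color have the same $T-c(T)$, and $c$ is extended to all translates of prototiles by $c(T+x)=c(T)+x$. Put $\Lambda_i=\{c(T) : T\in\mathcal{T},\ \ell(T)=i\}$, $\boldsymbol{\Lambda}=(\Lambda_i)_{i\le m}$ (the associated Delone multi-color set) and $\Lambda=\bigcup_{i=1}^m\Lambda_i$. The control points are admissible if $\bigcap_{i\le m}(\operatorname{supp}(T_i)-c(T_i))$ has non-empty interior. For admissible control points, $\boldsymbol{\Lambda}$ admits strong coincidence if for all $1\le i,j\le m$ there is a positive integer $L$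 with $\Omega^L(T_i-c(T_i))\cap\Omega^L(T_j-c(T_j))\neq\emptyset$ (i.e. these two patches share a common tile). **Multiple strong coincidence.** Let $\mathcal{G}=\bigcup_{k=0}^\infty Q^{-k}(\Lambda_i-\Lambda_i)$ for some $i\le m$ (it is independent of $i$ by primitivity, and $\Lambda_i-\Lambda_i$ does not depend on the choice of control points), and let $\langle\mathcal{G}\rangle$ be the additive subgroup of $\mathbb{R}^d$ generated by $\mathcal{G}$. $\mathcal{T}$ satisfies multiple strong coincidence of level $n$ if every $\boldsymbol{\Lambda}$ generated by admissible control points of $\Omega^n$ (over all choices of tile map of $\Omega^n$) with $\Lambda-\Lambda\subset\langle\mathcal{G}\rangle$ admits strong coincidence. *)

theory Defs
  imports "HOL-Analysis.Analysis" "HOL-Computational_Algebra.Group_Closure"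
begin

text \<open>
  The space is \<open>real ^ 'd\<close>, and the colors \<open>1, ..., m\<close> are the elements of a finite type \<open>'c\<close>.
  A substitution is given by the supports \<open>A i\<close> of the prototiles, the expansive matrix \<open>Q\<close>, and
  the sets \<open>D i j\<close> of the positions of the tiles of color \<open>i\<close> in the image of the prototile of
  color \<open>j\<close>.
\<close>

type_synonym ('d, 'c) tile = "(real ^ 'd) set \<times> 'c"

abbreviation supp :: "('d, 'c) tile \<Rightarrow> (real ^ 'd) set" where
  "supp T \<equiv> fst T"

abbreviation color :: "('d, 'c) tile \<Rightarrow> 'c" where
  "color T \<equiv> snd T"

definition is_tile :: "('d::finite, 'c) tile \<Rightarrow> bool" where
  "is_tile T \<longleftrightarrow> compact (supp T) \<and> supp T = closure (interior (supp T))"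

definition shift :: "real ^ 'd::finite \<Rightarrow> ('d, 'c) tile \<Rightarrow> ('d, 'c) tile" where
  "shift g T = ((\<lambda>x. g + x) ` supp T, color T)"

definition prototile :: "('c \<Rightarrow> (real ^ 'd) set) \<Rightarrow> 'c \<Rightarrow> ('d, 'c) tile" where
  "prototile A i = (A i, i)"

definition tiling :: "('c \<Rightarrow> (real ^ 'd::finite) set) \<Rightarrow> ('d, 'c) tile set \<Rightarrow> bool" where
  "tiling A \<T> \<longleftrightarrow>
     (\<forall>T\<in>\<T>. \<exists>i x. T = shift x (prototile A i)) \<and>
     (\<Union>T\<in>\<T>. supp T) = UNIV \<and>
     (\<forall>S\<in>\<T>. \<forall>T\<in>\<T>. S \<noteq> T \<longrightarrow> interior (supp S) \<inter> interior (supp T) = {})"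

definition patch_of :: "('d::finite, 'c) tile set \<Rightarrow> ('d, 'c) tile set \<Rightarrow> bool" where
  "patch_of \<T> P \<longleftrightarrow> finite P \<and> P \<subseteq> \<T>"

definition patch :: "('c \<Rightarrow> (real ^ 'd::finite) set) \<Rightarrow> ('d, 'c) tile set \<Rightarrow> bool" where
  "patch A P \<longleftrightarrow> (\<exists>\<T>. tiling A \<T> \<and> patch_of \<T> P)"

definition patch_supp :: "('d, 'c) tile set \<Rightarrow> (real ^ 'd) set" where
  "patch_supp P = (\<Union>T\<in>P. supp T)"

definition matpow :: "'a::semiring_1 ^ 'n ^ 'n \<Rightarrow> nat \<Rightarrow> 'a ^ 'n ^ 'n::finite" where
  "matpow M k = ((\<lambda>X. M ** X) ^^ k) (mat 1)"

definition expansive :: "real ^ 'd ^ 'd::finite \<Rightarrow> bool" where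
  "expansive Q \<longleftrightarrow>
     (\<forall>(z::complex) (v::complex ^ 'd).
        v \<noteq> 0 \<and> map_matrix complex_of_real Q *v v = z *s v \<longrightarrow> norm z > 1)"

definition is_substitution ::
  "('c::finite \<Rightarrow> (real ^ 'd::finite) set) \<Rightarrow> real ^ 'd ^ 'd \<Rightarrow>
   ('c \<Rightarrow> 'c \<Rightarrow> (real ^ 'd) set) \<Rightarrow> bool" where
  "is_substitution A Q D \<longleftrightarrow>
     (\<forall>i. is_tile (prototile A i)) \<and>
     expansive Q \<and>
     (\<forall>i j. finite (D i j)) \<and>
     (\<forall>j. patch A {shift u (prototile A i) | i u. u \<in> D i j}) \<and>
     (\<forall>j. (\<lambda>x. Q *v x) ` A j = (\<Union>i. \<Union>u\<in>D i j. (\<lambda>x. x + u) ` A i)) \<and>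
     (\<forall>j i i' u u'. u \<in> D i j \<and> u' \<in> D i' j \<and> (i, u) \<noteq> (i', u') \<longrightarrow>
        interior ((\<lambda>x. x + u) ` A i) \<inter> interior ((\<lambda>x. x + u') ` A i') = {})"

text \<open>
  The translation \<open>x\<close> with \<open>T = shift x (prototile A j)\<close> is unique because supports are bounded
  and non-empty, so the inner set is the single patch \<open>\<Omega>(T\<^sub>j) + Q x\<close>.
\<close>

definition Omega ::
  "('c::finite \<Rightarrow> (real ^ 'd::finite) set) \<Rightarrow> real ^ 'd ^ 'd \<Rightarrow>
   ('c \<Rightarrow> 'c \<Rightarrow> (real ^ 'd) set) \<Rightarrow> ('d, 'c) tile set \<Rightarrow> ('d, 'c) tile set" where
  "Omega A Q D P =
     (\<Union>T\<in>P. {shift (u + Q *v x) (prototile A i) | i j u x.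
                T = shift x (prototile A j) \<and> u \<in> D i j})"

definition primitive_substitution :: "('c::finite \<Rightarrow> 'c \<Rightarrow> (real ^ 'd) set) \<Rightarrow> bool" where
  "primitive_substitution D \<longleftrightarrow>
     (\<exists>k>0. \<forall>i j. matpow (\<chi> i j. card (D i j)) k $ i $ j > 0)"

definition substitution_tiling ::
  "('c::finite \<Rightarrow> (real ^ 'd::finite) set) \<Rightarrow> real ^ 'd ^ 'd \<Rightarrow>
   ('c \<Rightarrow> 'c \<Rightarrow> (real ^ 'd) set) \<Rightarrow> ('d, 'c) tile set \<Rightarrow> bool" where
  "substitution_tiling A Q D \<T> \<longleftrightarrow>
     tiling A \<T> \<and>
     (\<forall>P. patch_of \<T> P \<longrightarrow> (\<exists>k. \<exists>T\<in>\<T>. \<exists>g. shift g ` P \<subseteq> (Omega A Q D ^^ k) {T}))"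

definition flc :: "('d::finite, 'c) tile set \<Rightarrow> bool" where
  "flc \<T> \<longleftrightarrow>
     (\<forall>R>0. \<exists>F. finite F \<and>
        (\<forall>P. patch_of \<T> P \<and> diameter (patch_supp P) < R \<longrightarrow>
             (\<exists>P0\<in>F. \<exists>g. P = shift g ` P0)))"

definition self_affine_tiling ::
  "('c::finite \<Rightarrow> (real ^ 'd::finite) set) \<Rightarrow> real ^ 'd ^ 'd \<Rightarrow>
   ('c \<Rightarrow> 'c \<Rightarrow> (real ^ 'd) set) \<Rightarrow> ('d, 'c) tile set \<Rightarrow> bool" where
  "self_affine_tiling A Q D \<T> \<longleftrightarrow>
     is_substitution A Q D \<and> primitive_substitution D \<and>
     substitution_tiling A Q D \<T> \<and> flc \<T>"

definition rod :: "('d::finite, 'c) tile set \<Rightarrow> ('d, 'c) tile set \<Rightarrow> bool" where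
  "rod \<T> R \<longleftrightarrow>
     R \<subseteq> \<T> \<and> \<not> bounded (patch_supp R) \<and> connected (patch_supp R) \<and>
     (\<forall>S\<in>R. \<forall>T\<in>R. color S = color T)"

definition rod_tiling :: "('d::finite, 'c) tile set \<Rightarrow> bool" where
  "rod_tiling \<T> \<longleftrightarrow> (\<forall>T\<in>\<T>. \<exists>R. rod \<T> R \<and> T \<in> R)"

definition return_vectors :: "('d::finite, 'c) tile set \<Rightarrow> (real ^ 'd) set" where
  "return_vectors \<T> = {y. \<exists>U\<in>\<T>. \<exists>V\<in>\<T>. U = shift (- y) V}"

definition diff_set :: "'a::ab_group_add set \<Rightarrow> 'a set" where
  "diff_set X = {x - y | x y. x \<in> X \<and> y \<in> X}"

definition relatively_dense :: "'a::metric_space set \<Rightarrow> bool" where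
  "relatively_dense X \<longleftrightarrow> (\<exists>R>0. \<forall>x. \<exists>y\<in>X. dist x y \<le> R)"

definition delone :: "'a::metric_space set \<Rightarrow> bool" where
  "delone X \<longleftrightarrow> relatively_dense X \<and> uniform_discrete X"

definition meyer :: "'a::real_normed_vector set \<Rightarrow> bool" where
  "meyer X \<longleftrightarrow> delone X \<and> uniform_discrete (diff_set X)"

definition overlaps ::
  "('d::finite, 'c) tile set \<Rightarrow> (('d, 'c) tile \<times> (real ^ 'd) \<times> ('d, 'c) tile) set" where
  "overlaps \<T> =
     {(U, y, V). U \<in> \<T> \<and> V \<in> \<T> \<and> y \<in> return_vectors \<T> \<and>
        interior (supp U) \<inter> interior (supp (shift (- y) V)) \<noteq> {}}"

definition coincidence ::
  "('d::finite, 'c) tile \<times> (real ^ 'd) \<times> ('d, 'c) tile \<Rightarrow> bool" where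
  "coincidence \<O> = (case \<O> of (U, y, V) \<Rightarrow> U = shift (- y) V)"

definition inflate_overlap ::
  "('c::finite \<Rightarrow> (real ^ 'd::finite) set) \<Rightarrow> real ^ 'd ^ 'd \<Rightarrow>
   ('c \<Rightarrow> 'c \<Rightarrow> (real ^ 'd) set) \<Rightarrow> ('d, 'c) tile set \<Rightarrow> nat \<Rightarrow>
   ('d, 'c) tile \<times> (real ^ 'd) \<times> ('d, 'c) tile \<Rightarrow>
   (('d, 'c) tile \<times> (real ^ 'd) \<times> ('d, 'c) tile) set" where
  "inflate_overlap A Q D \<T> l \<O> =
     (case \<O> of (U, y, V) \<Rightarrow>
        {(U', matpow Q l *v y, V') | U' V'.
           U' \<in> (Omega A Q D ^^ l) {U} \<and> V' \<in> (Omega A Q D ^^ l) {V} \<and>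
           (U', matpow Q l *v y, V') \<in> overlaps \<T>})"

definition overlap_coincidence ::
  "('c::finite \<Rightarrow> (real ^ 'd::finite) set) \<Rightarrow> real ^ 'd ^ 'd \<Rightarrow>
   ('c \<Rightarrow> 'c \<Rightarrow> (real ^ 'd) set) \<Rightarrow> ('d, 'c) tile set \<Rightarrow> bool" where
  "overlap_coincidence A Q D \<T> \<longleftrightarrow>
     (\<exists>l>0. \<forall>\<O>\<in>overlaps \<T>. \<exists>\<O>'\<in>inflate_overlap A Q D \<T> l \<O>. coincidence \<O>')"

text \<open>
  Only the values of \<open>\<gamma>\<close> on \<open>\<T>\<close> matter; being a function on all tiles is an artefact of totality.
\<close>

definition tile_map ::
  "('c::finite \<Rightarrow> (real ^ 'd::finite) set) \<Rightarrow> real ^ 'd ^ 'd \<Rightarrow>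
   ('c \<Rightarrow> 'c \<Rightarrow> (real ^ 'd) set) \<Rightarrow> ('d, 'c) tile set \<Rightarrow> nat \<Rightarrow>
   (('d, 'c) tile \<Rightarrow> ('d, 'c) tile) \<Rightarrow> bool" where
  "tile_map A Q D \<T> n \<gamma> \<longleftrightarrow>
     (\<forall>T\<in>\<T>. \<gamma> T \<in> \<T> \<and> \<gamma> T \<in> (Omega A Q D ^^ n) {T}) \<and>
     (\<forall>T\<in>\<T>. \<forall>T'\<in>\<T>. \<forall>x. T' = shift x T \<longrightarrow> \<gamma> T' = shift (matpow Q n *v x) (\<gamma> T))"

text \<open>
  \<open>control_point_in\<close> is meant for tiles of \<open>\<T>\<close> only, \<open>control_point\<close> for all translates of them
  (in particular for the prototiles, which need not belong to \<open>\<T>\<close>). Since \<open>Q\<close> is invertible,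
  \<open>Q\<^sup>-\<^sup>n\<^sup>k X\<close> is a preimage.
\<close>

definition control_point_in ::
  "real ^ 'd ^ 'd \<Rightarrow> nat \<Rightarrow> (('d::finite, 'c) tile \<Rightarrow> ('d, 'c) tile) \<Rightarrow> ('d, 'c) tile \<Rightarrow> real ^ 'd"
  where
  "control_point_in Q n \<gamma> T =
     (THE x. x \<in> (\<Inter>k\<in>{1..}. (\<lambda>x. matpow Q (n * k) *v x) -` supp ((\<gamma> ^^ k) T)))"

definition control_point ::
  "real ^ 'd ^ 'd \<Rightarrow> ('d::finite, 'c) tile set \<Rightarrow> nat \<Rightarrow> (('d, 'c) tile \<Rightarrow> ('d, 'c) tile) \<Rightarrow>
   ('d, 'c) tile \<Rightarrow> real ^ 'd" where
  "control_point Q \<T> n \<gamma> S =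
     (THE p. \<exists>T\<in>\<T>. \<exists>x. S = shift x T \<and> p = control_point_in Q n \<gamma> T + x)"

definition control_set ::
  "('d, 'c) tile set \<Rightarrow> (('d, 'c) tile \<Rightarrow> real ^ 'd) \<Rightarrow> 'c \<Rightarrow> (real ^ 'd) set" where
  "control_set \<T> c i = {c T | T. T \<in> \<T> \<and> color T = i}"

definition centered_prototile ::
  "('c \<Rightarrow> (real ^ 'd::finite) set) \<Rightarrow> (('d, 'c) tile \<Rightarrow> real ^ 'd) \<Rightarrow> 'c \<Rightarrow> ('d, 'c) tile" where
  "centered_prototile A c i = shift (- c (prototile A i)) (prototile A i)"

definition admissible ::
  "('c \<Rightarrow> (real ^ 'd::finite) set) \<Rightarrow> (('d, 'c) tile \<Rightarrow> real ^ 'd) \<Rightarrow> bool" where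
  "admissible A c \<longleftrightarrow> interior (\<Inter>i. supp (centered_prototile A c i)) \<noteq> {}"

definition strong_coincidence ::
  "('c::finite \<Rightarrow> (real ^ 'd::finite) set) \<Rightarrow> real ^ 'd ^ 'd \<Rightarrow>
   ('c \<Rightarrow> 'c \<Rightarrow> (real ^ 'd) set) \<Rightarrow> (('d, 'c) tile \<Rightarrow> real ^ 'd) \<Rightarrow> bool" where
  "strong_coincidence A Q D c \<longleftrightarrow>
     (\<forall>i j. \<exists>L>0. (Omega A Q D ^^ L) {centered_prototile A c i} \<inter>
                  (Omega A Q D ^^ L) {centered_prototile A c j} \<noteq> {})"

text \<open>
  The union is the same for every color \<open>i\<close> by primitivity, and for every choice of control
  points; \<open>SOME\<close> fixes an arbitrary color.
\<close>

definition return_module :: "real ^ 'd ^ 'd \<Rightarrow> ('c \<Rightarrow> (real ^ 'd::finite) set) \<Rightarrow> (real ^ 'd) set" where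
  "return_module Q \<Lambda> =
     (let i = (SOME i. True)
      in group_closure (\<Union>k. (\<lambda>x. matpow Q k *v x) -` diff_set (\<Lambda> i)))"

definition multiple_strong_coincidence ::
  "('c::finite \<Rightarrow> (real ^ 'd::finite) set) \<Rightarrow> real ^ 'd ^ 'd \<Rightarrow>
   ('c \<Rightarrow> 'c \<Rightarrow> (real ^ 'd) set) \<Rightarrow> ('d, 'c) tile set \<Rightarrow> nat \<Rightarrow> bool" where
  "multiple_strong_coincidence A Q D \<T> n \<longleftrightarrow>
     (\<forall>\<gamma>. tile_map A Q D \<T> n \<gamma> \<longrightarrow>
        (let c = control_point Q \<T> n \<gamma>; \<Lambda> = control_set \<T> c
         in admissible A c \<and> diff_set (\<Union>i. \<Lambda> i) \<subseteq> return_module Q \<Lambda>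
            \<longrightarrow> strong_coincidence A Q D c))"

end

theory Submission
  imports Defs "HOL-Computational_Algebra.Fundamental_Theorem_Algebra"
begin

text \<open>
  An overlap \<open>(U, y, V)\<close> is viewed as the pair of the tiles \<open>U\<close> and \<open>W = V - y\<close>: the first
  belongs to \<open>\<T>\<close>, the second to the translate \<open>\<T> - y\<close> by a return vector, and their interiors
  meet. Overlap coincidence says that for one common level \<open>l\<close> the patches \<open>\<Omega>\<^sup>l U\<close> and \<open>\<Omega>\<^sup>l W\<close>
  share a tile, for every such pair. If it holds, then multiple strong coincidence holds at every
  level. If it fails, a level \<open>n\<close> and a tile map of \<open>\<Omega>\<^sup>n\<close> are constructed whose control points
  are admissible and have their differences in the return module, but violate strong coincidence.

  Suppose that overlap coincidence holds. Only finitely many tiles of the tilings \<open>\<T> - y\<close> meet a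
  given tile, so repeated coincidences produce a tile common to all the tilings \<open>\<T> - Q\<^sup>M y\<close>, where
  \<open>y\<close> runs through the return vectors (\<open>algebraic_coincidence\<close>). Hence \<open>Q\<^sup>M\<close> maps differences of
  return vectors to return vectors, and every element of the return module is mapped to a return
  vector by some power of \<open>Q\<close>. Two tiles that are moved so that their control points agree have
  interior points in common by admissibility, and the vector that moves them into this position is
  in the return module. So a power of \<open>\<Omega>\<close> turns them into patches that contain a genuine overlap,
  and the overlap leads to a common tile (\<open>strong_coincidence_if_overlap_coincidence\<close>).

  Suppose that overlap coincidence fails. The Meyer property makes the pairs \<open>(U, W)\<close> finite in
  number up to translation (\<open>finite_pair_classes\<close>), so some pair never leads to a common tile. Such
  a pair has descendants of two different colors (\<open>never_coincident_reaches_two_colors\<close>). Otherwise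
  consider a maximal connected cluster of tiles of one color that is bounded; it exists because
  \<open>\<T>\<close> is not a rod tiling. It has a copy in the region where the descendants of \<open>U\<close> and \<open>W\<close>
  overlap, and since tiles are connected, the descendants of \<open>W\<close> that meet the copy cover exactly
  the same set. But two finite families of translates of one compact set with the same union have a
  member in common (\<open>common_translate_of_equal_unions\<close>), which is a coincidence.

  Taking descendants in the interiors of their ancestors and applying the pigeonhole principle, one
  finds a pair \<open>(U, W)\<close> of two colors that never coincides and has the pair \<open>(U + z, W + z)\<close> among
  its descendants of some level \<open>n\<close> (\<open>recurrent_never_coincident_pair\<close>). The tile map that sends
  \<open>U\<close> to \<open>U + z\<close>, the tile \<open>W + y\<close> of \<open>\<T>\<close> to \<open>W + z + Q\<^sup>n y\<close>, and the tiles of all other colors to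
  tiles of the color of \<open>U\<close>, gives \<open>U\<close> and \<open>W\<close> the same control point. All its control points are interior, hence admissible; their
  differences are in the return module; and strong coincidence for the colors of \<open>U\<close> and \<open>W\<close> would
  be a coincidence of \<open>U\<close> and \<open>W\<close>.
\<close>

section \<open>Powers of an expansive matrix\<close>

lemma scalar_recursion_tendsto_0:
  fixes u w :: "nat \<Rightarrow> complex"
  assumes rec: "\<And>k. u (Suc k) = a * u k + w k" and a: "norm a < 1" and w: "w \<longlonglongrightarrow> 0"
  shows "u \<longlonglongrightarrow> 0"
proof -
  let ?r = "norm a"
  have "\<exists>N. \<forall>k\<ge>N. norm (u k) < e" if e: "e > 0" for e
  proof -
    define h where "h = e * (1 - ?r) / 2"
    have h: "h > 0" using e a by (simp add: h_def)
    obtain N where N: "\<And>k. k \<ge> N \<Longrightarrow> norm (w k) < h"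
      using w h unfolding LIMSEQ_iff by auto
    have bound: "norm (u (N + k)) \<le> ?r ^ k * norm (u N) + e / 2" for k
    proof (induction k)
      case 0
      then show ?case using e by simp
    next
      case (Suc k)
      have "norm (u (N + Suc k)) \<le> ?r * norm (u (N + k)) + norm (w (N + k))"
        using norm_triangle_ineq[of "a * u (N + k)" "w (N + k)"] by (simp add: rec norm_mult)
      also have "\<dots> \<le> ?r * (?r ^ k * norm (u N) + e / 2) + h"
        using Suc N[of "N + k"] by (intro add_mono mult_left_mono) auto
      also have "\<dots> = ?r ^ Suc k * norm (u N) + e / 2"
        by (simp add: h_def field_simps)
      finally show ?case .
    qed
    have "(\<lambda>k. ?r ^ k * norm (u N)) \<longlonglongrightarrow> 0"
      using tendsto_mult_left_zero[OF LIMSEQ_realpow_zero[OF _ a]] by auto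
    then obtain M where M: "\<And>k. k \<ge> M \<Longrightarrow> \<bar>?r ^ k * norm (u N)\<bar> < e / 2"
      using e unfolding LIMSEQ_iff by (metis diff_zero half_gt_zero real_norm_def)
    have "norm (u k) < e" if "k \<ge> N + M" for k
    proof -
      have "norm (u (N + (k - N))) \<le> ?r ^ (k - N) * norm (u N) + e / 2" by (rule bound)
      moreover have "?r ^ (k - N) * norm (u N) < e / 2" using M[of "k - N"] that by auto
      ultimately show ?thesis using that by simp
    qed
    then show ?thesis by blast
  qed
  then show ?thesis unfolding LIMSEQ_iff by simp
qed

definition poly_apply :: "complex poly \<Rightarrow> complex ^ 'n ^ 'n \<Rightarrow> complex ^ 'n \<Rightarrow> complex ^ 'n::finite"
  where "poly_apply p M v = (\<Sum>i\<le>degree p. coeff p i *s (((*v) M) ^^ i) v)"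

lemma poly_apply_eq_sum:
  assumes "degree p \<le> N"
  shows "poly_apply p M v = (\<Sum>i\<le>N. coeff p i *s (((*v) M) ^^ i) v)"
  unfolding poly_apply_def using assms
  by (intro sum.mono_neutral_left) (auto simp: coeff_eq_0 not_le)

lemma funpow_matrix_diff:
  fixes M :: "complex ^ 'n ^ 'n"
  shows "(((*v) M) ^^ i) (x - y) = (((*v) M) ^^ i) x - (((*v) M) ^^ i) y"
  by (induction i) (auto simp: matrix_vector_mult_diff_distrib)

lemma funpow_matrix_smult:
  fixes M :: "complex ^ 'n ^ 'n"
  shows "(((*v) M) ^^ i) (a *s x) = a *s (((*v) M) ^^ i) x"
  by (induction i) (auto simp: vector_scalar_commute)

lemma poly_apply_linear_factor:
  "poly_apply ([:- a, 1:] * q) M v = poly_apply q M (M *v v - a *s v)"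
proof (cases "q = 0")
  case True
  then show ?thesis by (simp add: poly_apply_def)
next
  case False
  let ?N = "degree q" and ?f = "\<lambda>i. (((*v) M) ^^ i) v"
  have deg: "degree ([:- a, 1:] * q) = Suc ?N" using False
    by (subst degree_mult_eq) auto
  have "poly_apply ([:- a, 1:] * q) M v = (\<Sum>i\<le>Suc ?N. coeff ([:- a, 1:] * q) i *s ?f i)"
    using deg by (simp add: poly_apply_def)
  also have "\<dots> = (\<Sum>i\<le>Suc ?N. coeff (pCons 0 q) i *s ?f i) - (\<Sum>i\<le>Suc ?N. (a * coeff q i) *s ?f i)"
    unfolding sum_subtractf[symmetric] by (intro sum.cong) (auto simp: vec_eq_iff algebra_simps)
  also have "(\<Sum>i\<le>Suc ?N. coeff (pCons 0 q) i *s ?f i) = (\<Sum>i\<le>?N. coeff q i *s ?f (Suc i))"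
    by (subst sum.atMost_Suc_shift) simp
  also have "(\<Sum>i\<le>Suc ?N. (a * coeff q i) *s ?f i) = (\<Sum>i\<le>?N. (a * coeff q i) *s ?f i)"
    by (simp add: coeff_eq_0)
  also have "(\<Sum>i\<le>?N. coeff q i *s ?f (Suc i)) - (\<Sum>i\<le>?N. (a * coeff q i) *s ?f i) =
      poly_apply q M (M *v v - a *s v)"
    unfolding poly_apply_def sum_subtractf[symmetric] funpow_matrix_diff funpow_matrix_smult
    by (intro sum.cong) (auto simp: vector_ssub_ldistrib vector_smult_assoc mult.commute funpow_swap1)
  finally show ?thesis .
qed

text \<open>
  Induction on the degree of \<open>p\<close>. Split off a root \<open>a\<close> and put \<open>w = M v - a v\<close>, to which the
  induction hypothesis applies. If \<open>a\<close> has modulus less than \<open>1\<close>, the iterates of \<open>v\<close> satisfy a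
  contracting recursion whose inhomogeneity, the iterates of \<open>w\<close>, tends to \<open>0\<close>. Otherwise \<open>a\<close> is
  not an eigenvalue, and the iterates of \<open>v\<close> are the images of those of \<open>w\<close> under the inverse
  of \<open>M - a\<close>.
\<close>

lemma matrix_powers_tendsto_0_if_annihilated:
  fixes M :: "complex ^ 'n ^ 'n::finite"
  assumes ev: "\<And>z w. w \<noteq> 0 \<Longrightarrow> M *v w = z *s w \<Longrightarrow> norm z < 1"
    and "p \<noteq> 0" "poly_apply p M v = 0"
  shows "(\<lambda>k. (((*v) M) ^^ k) v) \<longlonglongrightarrow> 0"
  using assms(2,3)
proof (induction "degree p" arbitrary: p v rule: less_induct)
  case less
  show ?case
  proof (cases "degree p = 0")
    case True
    then obtain c where c: "p = [:c:]" by (metis degree_eq_zeroE)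
    then have "c *s v = 0" using less.prems by (simp add: poly_apply_def)
    then have "v = 0" using c less.prems by (simp add: vec_eq_iff)
    moreover have "(((*v) M) ^^ k) 0 = 0" for k
      by (induction k) (auto simp: matrix_vector_mult_0_right)
    ultimately show ?thesis by simp
  next
    case False
    then have "\<not> constant (poly p)" by (simp add: constant_degree)
    then obtain a where "poly p a = 0" using fundamental_theorem_of_algebra by blast
    then obtain q where q: "p = [:- a, 1:] * q" by (auto simp: poly_eq_0_iff_dvd dvd_def)
    have q0: "q \<noteq> 0" using less.prems q by auto
    have dq: "degree q < degree p" using q0 unfolding q by (subst degree_mult_eq) auto
    define w where "w = M *v v - a *s v"
    have "poly_apply q M w = 0" using less.prems unfolding q poly_apply_linear_factor w_def by simp
    then have wlim: "(\<lambda>k. (((*v) M) ^^ k) w) \<longlonglongrightarrow> 0"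
      using less.hyps[OF dq q0] by blast
    have step: "(((*v) M) ^^ k) w = (((*v) M) ^^ Suc k) v - a *s (((*v) M) ^^ k) v" for k
      unfolding w_def funpow_matrix_diff funpow_matrix_smult by (simp add: funpow_swap1)
    show ?thesis
    proof (cases "norm a < 1")
      case True
      have "(\<lambda>k. (((*v) M) ^^ k) v $ i) \<longlonglongrightarrow> 0" for i
      proof (rule scalar_recursion_tendsto_0[OF _ True])
        show "(((*v) M) ^^ Suc k) v $ i = a * (((*v) M) ^^ k) v $ i + (((*v) M) ^^ k) w $ i" for k
          unfolding step by simp
        show "(\<lambda>k. (((*v) M) ^^ k) w $ i) \<longlonglongrightarrow> 0"
          using tendsto_vec_nth[OF wlim, of i] by simp
      qed
      then show ?thesis by (intro vec_tendstoI) simp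
    next
      case False
      have ma: "mat a *v x = a *s x" for x :: "complex ^ 'n"
        by (simp add: vec_eq_iff matrix_vector_mult_def mat_def if_distrib[of "\<lambda>t. t * _"] cong: if_cong)
      have mm: "(M - mat a) *v x = M *v x - a *s x" for x
        by (simp add: matrix_vector_mult_diff_rdistrib ma)
      have "inj ((*v) (M - mat a))"
      proof (rule injI)
        fix x y assume "(M - mat a) *v x = (M - mat a) *v y"
        then have "M *v (x - y) = a *s (x - y)"
          unfolding mm matrix_vector_mult_diff_distrib vector_ssub_ldistrib by (simp add: algebra_simps ma)
        then show "x = y" using ev[of "x - y" a] False by auto
      qed
      then obtain N where N: "N ** (M - mat a) = mat 1"
        using matrix_left_invertible_injective by blast
      have "(((*v) M) ^^ k) v = N *v (((*v) M) ^^ k) w" for k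
      proof -
        have "(((*v) M) ^^ k) w = (M - mat a) *v ((((*v) M) ^^ k) v)"
          unfolding mm step by simp
        then show ?thesis by (simp add: matrix_vector_mul_assoc N)
      qed
      moreover have "(\<lambda>k. N *v (((*v) M) ^^ k) w) \<longlonglongrightarrow> N *v 0"
      proof (rule vec_tendstoI)
        fix i
        have "(\<lambda>k. \<Sum>j\<in>UNIV. N $ i $ j * (((*v) M) ^^ k) w $ j) \<longlonglongrightarrow> (\<Sum>j\<in>UNIV. N $ i $ j * 0 $ j)"
          by (intro tendsto_sum tendsto_mult_left tendsto_vec_nth[OF wlim])
        then show "(\<lambda>k. (N *v (((*v) M) ^^ k) w) $ i) \<longlonglongrightarrow> (N *v 0) $ i"
          by (simp add: matrix_vector_mult_def)
      qed
      ultimately show ?thesis by simp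
    qed
  qed
qed

text \<open>
  In a space of finite real dimension, the iterates of \<open>v\<close> are linearly dependent over the reals.
\<close>

lemma annihilating_polynomial:
  fixes M :: "complex ^ 'n ^ 'n::finite"
  shows "\<exists>p. p \<noteq> 0 \<and> poly_apply p M v = 0"
proof -
  let ?f = "\<lambda>i. (((*v) M) ^^ i) v"
  define N where "N = DIM(complex ^ 'n)"
  show ?thesis
  proof (cases "inj_on ?f {..N}")
    case False
    then obtain i j where ij: "i < j" "?f i = ?f j"
      unfolding inj_on_def by (metis linorder_neqE_nat)
    define p where "p = monom (1::complex) j - monom 1 i"
    have cp: "coeff p k = (if k = j then 1 else 0) - (if k = i then 1 else 0)" for k
      by (simp add: p_def)
    have "coeff p j \<noteq> 0" using ij by (simp add: cp)
    then have "p \<noteq> 0" by auto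
    moreover have "degree p \<le> j" by (rule degree_le) (use ij in \<open>auto simp: cp\<close>)
    then have "poly_apply p M v = (\<Sum>k\<le>j. (if k = j then ?f k else 0) - (if k = i then ?f k else 0))"
      unfolding poly_apply_eq_sum[OF \<open>degree p \<le> j\<close>]
      by (intro sum.cong) (auto simp: cp vec_eq_iff)
    then have "poly_apply p M v = 0" using ij by (simp add: sum_subtractf)
    ultimately show ?thesis by blast
  next
    case True
    have "dependent (?f ` {..N})"
      by (rule dependent_biggerset) (use True in \<open>simp add: card_image N_def\<close>)
    then obtain u where u: "\<exists>x\<in>?f ` {..N}. u x \<noteq> (0::real)" "(\<Sum>x\<in>?f ` {..N}. u x *\<^sub>R x) = 0"
      by (auto simp: dependent_finite)
    define p where "p = (\<Sum>i\<le>N. monom (complex_of_real (u (?f i))) i)"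
    have cp: "coeff p k = (if k \<le> N then complex_of_real (u (?f k)) else 0)" for k
      by (simp add: p_def coeff_sum)
    obtain i where "i \<le> N" "u (?f i) \<noteq> 0" using u(1) by auto
    then have "coeff p i \<noteq> 0" by (simp add: cp)
    then have "p \<noteq> 0" by auto
    moreover have dp: "degree p \<le> N" by (rule degree_le) (auto simp: cp)
    have "poly_apply p M v = (\<Sum>i\<le>N. u (?f i) *\<^sub>R ?f i)"
      unfolding poly_apply_eq_sum[OF dp]
      by (intro sum.cong) (auto simp: cp vec_eq_iff scaleR_conv_of_real[where 'a = complex])
    then have "poly_apply p M v = 0" using u(2) True by (simp add: sum.reindex)
    ultimately show ?thesis by blast
  qed
qed

lemma matpow_Suc_vec: "matpow Q (Suc k) *v x = Q *v (matpow Q k *v x)"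
  by (simp add: matpow_def matrix_vector_mul_assoc)

lemma matpow_0_vec [simp]: "matpow (Q :: real ^ 'd ^ 'd::finite) 0 *v x = x"
  by (simp add: matpow_def)

lemma matpow_add_vec:
  fixes Q :: "real ^ 'd ^ 'd::finite"
  shows "matpow Q (k + l) *v x = matpow Q k *v (matpow Q l *v x)"
  by (induction k) (auto simp: matpow_Suc_vec)

definition complexify :: "real ^ 'd \<Rightarrow> complex ^ 'd::finite" where
  "complexify v = (\<chi> i. complex_of_real (v $ i))"

lemma complexify_matrix_vector:
  "map_matrix complex_of_real Q *v complexify v = complexify (Q *v v)"
  by (simp add: complexify_def vec_eq_iff matrix_vector_mult_def map_matrix_def)

lemma expansive_inj:
  fixes Q :: "real ^ 'd ^ 'd::finite"
  assumes "expansive Q"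
  shows "inj ((*v) Q)"
  unfolding linear_injective_0[OF matrix_vector_mul_linear]
proof (intro allI impI, rule ccontr)
  fix v assume v: "Q *v v = 0" "v \<noteq> 0"
  have "complexify v \<noteq> 0" using v(2) by (auto simp: complexify_def vec_eq_iff)
  moreover have "map_matrix complex_of_real Q *v complexify v = 0 *s complexify v"
    unfolding complexify_matrix_vector v by (simp add: complexify_def vec_eq_iff)
  ultimately have "norm (0::complex) > 1" using assms unfolding expansive_def by blast
  then show False by simp
qed

text \<open>
  All eigenvalues of the inverse of \<open>Q\<close> have modulus less than \<open>1\<close>, so its powers tend to \<open>0\<close> at each
  vector of the standard basis, hence uniformly on the unit ball. Stating the result as a lower bound
  for the powers of \<open>Q\<close> keeps the inverse out of everything that follows.
\<close>

lemma expansive_powers_expand: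
  fixes Q :: "real ^ 'd ^ 'd::finite"
  assumes "expansive Q" and "\<delta> > 0"
  shows "\<exists>k0. \<forall>k\<ge>k0. \<forall>x. norm x \<le> \<delta> * norm (matpow Q k *v x)"
proof -
  obtain B where B: "B ** Q = mat 1"
    using expansive_inj[OF assms(1)] matrix_left_invertible_injective[of Q] by blast
  then have B': "Q ** B = mat 1" using matrix_left_right_inverse by blast
  let ?c = "map_matrix complex_of_real"
  have cmult: "?c (X ** Y) = ?c X ** ?c Y" for X Y :: "real ^ 'd ^ 'd"
    by (simp add: map_matrix_def matrix_matrix_mult_def vec_eq_iff)
  have c1: "?c (mat 1 :: real ^ 'd ^ 'd) = mat 1"
    by (simp add: map_matrix_def mat_def vec_eq_iff)
  have ev: "norm z < 1" if w: "w \<noteq> 0" "?c B *v w = z *s w" for z w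
  proof -
    have "w = ?c Q *v (?c B *v w)"
      by (simp add: matrix_vector_mul_assoc cmult[symmetric] B' c1)
    also have "\<dots> = z *s (?c Q *v w)" by (simp add: w vector_scalar_commute)
    finally have eq: "w = z *s (?c Q *v w)" .
    then have z: "z \<noteq> 0" using w(1) by auto
    have "?c Q *v w = inverse z *s (z *s (?c Q *v w))" using z by simp
    then have "?c Q *v w = inverse z *s w" using eq by simp
    then have "norm (inverse z) > 1" using assms(1) w(1) unfolding expansive_def by blast
    then show ?thesis using z by (simp add: norm_inverse one_less_inverse_iff)
  qed
  have Bpow: "(((*v) (?c B)) ^^ k) (complexify v) = complexify (matpow B k *v v)" for k v
    by (induction k) (auto simp: matpow_Suc_vec complexify_matrix_vector)
  have lim: "(\<lambda>k. matpow B k *v v) \<longlonglongrightarrow> 0" for v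
  proof (rule vec_tendstoI)
    fix i
    obtain p where "p \<noteq> 0" "poly_apply p (?c B) (complexify v) = 0"
      using annihilating_polynomial by blast
    then have "(\<lambda>k. (((*v) (?c B)) ^^ k) (complexify v)) \<longlonglongrightarrow> 0"
      by (intro matrix_powers_tendsto_0_if_annihilated[of "?c B"]) (use ev in auto)
    from tendsto_vec_nth[OF this, of i]
    have "(\<lambda>k. complex_of_real ((matpow B k *v v) $ i)) \<longlonglongrightarrow> complex_of_real 0"
      unfolding Bpow by (simp add: complexify_def)
    then show "(\<lambda>k. (matpow B k *v v) $ i) \<longlonglongrightarrow> 0 $ i"
      unfolding tendsto_of_real_iff by simp
  qed
  have "(\<lambda>k. \<Sum>b\<in>Basis. norm (matpow B k *v b)) \<longlonglongrightarrow> (\<Sum>b\<in>(Basis::(real^'d) set). 0)"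
    by (intro tendsto_sum tendsto_norm_zero lim)
  then obtain k0 where k0: "\<And>k. k \<ge> k0 \<Longrightarrow> (\<Sum>b\<in>(Basis::(real^'d) set). norm (matpow B k *v b)) < \<delta>"
    using assms(2) unfolding LIMSEQ_iff by (force simp: abs_less_iff)
  have BQ: "matpow B k *v (matpow Q k *v x) = x" for k x
  proof (induction k arbitrary: x)
    case (Suc k)
    have "matpow B (Suc k) *v (matpow Q (Suc k) *v x) = matpow B (k + 1) *v (matpow Q (1 + k) *v x)"
      by simp
    also have "\<dots> = matpow B k *v ((B ** Q) *v (matpow Q k *v x))"
      unfolding matpow_add_vec by (simp add: matpow_Suc_vec flip: matrix_vector_mul_assoc)
    also have "\<dots> = x" using Suc by (simp add: B)
    finally show ?case .
  qed simp
  have "norm x \<le> \<delta> * norm (matpow Q k *v x)" if "k \<ge> k0" for k x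
  proof -
    let ?y = "matpow Q k *v x"
    have "x = matpow B k *v (\<Sum>b\<in>Basis. (?y \<bullet> b) *\<^sub>R b)"
      unfolding euclidean_representation by (simp add: BQ)
    also have "\<dots> = (\<Sum>b\<in>Basis. (?y \<bullet> b) *\<^sub>R (matpow B k *v b))"
      by (simp add: linear_sum[OF matrix_vector_mul_linear] linear_cmul[OF matrix_vector_mul_linear])
    finally have "norm x \<le> (\<Sum>b\<in>Basis. norm ((?y \<bullet> b) *\<^sub>R (matpow B k *v b)))"
      using norm_sum[of "\<lambda>b. (?y \<bullet> b) *\<^sub>R (matpow B k *v b)" Basis] by (metis (lifting))
    also have "\<dots> \<le> (\<Sum>b\<in>Basis. norm ?y * norm (matpow B k *v b))"
      by (intro sum_mono) (auto simp: Basis_le_norm intro!: mult_right_mono)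
    also have "\<dots> = norm ?y * (\<Sum>b\<in>Basis. norm (matpow B k *v b))"
      by (simp add: sum_distrib_left)
    also have "\<dots> \<le> norm ?y * \<delta>" using k0[OF that] by (intro mult_left_mono) auto
    finally show ?thesis by (simp add: mult.commute)
  qed
  then show ?thesis by blast
qed

section \<open>Unions of translates and uniformly discrete sets\<close>

text \<open>
  Take a linear functional that is injective on \<open>F \<union> F'\<close>. Its maximum over \<open>F + A\<close> is the sum of
  its maxima over \<open>F\<close> and over \<open>A\<close>, and likewise for \<open>F'\<close>. So the maxima over \<open>F\<close> and \<open>F'\<close> agree,
  and by injectivity they are attained at the same vector.
\<close>

lemma common_translate_of_equal_unions:
  fixes A :: "'a::euclidean_space set"
  assumes "compact A" "A \<noteq> {}" "finite F" "F \<noteq> {}" "finite F'" "F' \<noteq> {}"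
    and eq: "(\<Union>f\<in>F. (+) f ` A) = (\<Union>f\<in>F'. (+) f ` A)"
  shows "F \<inter> F' \<noteq> {}"
proof -
  let ?P = "(\<lambda>(f, g). f - g) ` ((F \<union> F') \<times> (F \<union> F')) - {0}"
  \<comment> \<open>Finitely many hyperplanes do not fill the space, so a functional that separates the points of
    \<open>F \<union> F'\<close> exists.\<close>
  have "negligible (\<Union>w\<in>?P. {x. w \<bullet> x = 0})"
    using assms(3,5) by (intro negligible_Union) (auto intro!: negligible_hyperplane)
  then have "(\<Union>w\<in>?P. {x. w \<bullet> x = 0}) \<noteq> UNIV" using non_negligible_UNIV by metis
  then obtain v where v: "v \<notin> (\<Union>w\<in>?P. {x. w \<bullet> x = 0})" by blast
  have inj: "f = g" if "f \<in> F \<union> F'" "g \<in> F \<union> F'" "v \<bullet> f = v \<bullet> g" for f g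
  proof (rule ccontr)
    assume "f \<noteq> g"
    then have "f - g \<in> ?P" using that by force
    then have "(f - g) \<bullet> v \<noteq> 0" using v by blast
    then show False using that(3) by (metis inner_commute inner_diff_left right_minus_eq)
  qed
  have "continuous_on A (\<lambda>x. v \<bullet> x)" by (intro continuous_intros)
  then obtain a where a: "a \<in> A" "\<And>x. x \<in> A \<Longrightarrow> v \<bullet> x \<le> v \<bullet> a"
    using continuous_attains_sup[OF assms(1,2)] by blast
  have mx: "\<exists>f\<in>S. \<forall>g\<in>S. v \<bullet> g \<le> v \<bullet> f" if "finite S" "S \<noteq> {}" for S
  proof -
    have "Max ((\<bullet>) v ` S) \<in> (\<bullet>) v ` S" using that by (intro Max_in) auto
    then obtain f where "f \<in> S" "v \<bullet> f = Max ((\<bullet>) v ` S)" by auto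
    then show ?thesis using that(1) by (intro bexI[of _ f]) auto
  qed
  obtain f where f: "f \<in> F" "\<And>g. g \<in> F \<Longrightarrow> v \<bullet> g \<le> v \<bullet> f"
    using mx[OF assms(3,4)] by blast
  obtain f' where f': "f' \<in> F'" "\<And>g. g \<in> F' \<Longrightarrow> v \<bullet> g \<le> v \<bullet> f'"
    using mx[OF assms(5,6)] by blast
  have "f + a \<in> (\<Union>f\<in>F'. (+) f ` A)" using eq f a by blast
  then obtain g b where gb: "g \<in> F'" "b \<in> A" "f + a = g + b" by auto
  then have "v \<bullet> f + v \<bullet> a = v \<bullet> g + v \<bullet> b" by (metis inner_add_right)
  then have 1: "v \<bullet> f \<le> v \<bullet> f'"
    using f'(2)[OF gb(1)] a(2)[OF gb(2)] by linarith
  have "f' + a \<in> (\<Union>f\<in>F. (+) f ` A)" using eq f' a by blast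
  then obtain g b where gb: "g \<in> F" "b \<in> A" "f' + a = g + b" by auto
  then have "v \<bullet> f' + v \<bullet> a = v \<bullet> g + v \<bullet> b" by (metis inner_add_right)
  then have 2: "v \<bullet> f' \<le> v \<bullet> f"
    using f(2)[OF gb(1)] a(2)[OF gb(2)] by linarith
  from 1 2 inj[of f f'] f(1) f'(1) show ?thesis by auto
qed

lemma uniform_discrete_finite_Int_bounded:
  fixes X :: "'a::euclidean_space set"
  assumes "uniform_discrete X" "bounded B"
  shows "finite (X \<inter> B)"
proof -
  have "uniform_discrete (X \<inter> B)" using assms(1) by (rule uniform_discrete_subset) simp
  moreover have "bounded (X \<inter> B)" using assms(2) by (rule bounded_subset) simp
  ultimately show ?thesis unfolding uniform_discrete_finite_iff[symmetric] by (rule conjI)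
qed

section \<open>Tiles and their inflations\<close>

lemma color_shift [simp]: "color (shift x T) = color T"
  by (simp add: shift_def)

lemma supp_shift [simp]: "supp (shift x T) = (+) x ` supp T"
  by (simp add: shift_def)

lemma shift_shift [simp]: "shift x (shift y T) = shift (x + y) T"
  by (simp add: shift_def image_image add.assoc)

lemma shift_0 [simp]: "shift 0 T = T"
  by (simp add: shift_def)

lemma shift_inject [simp]: "shift x S = shift x T \<longleftrightarrow> S = T"
  by (metis ab_left_minus shift_0 shift_shift)

lemma shift_minus_eq_iff: "shift (- x) S = T \<longleftrightarrow> S = shift x T"
  by (metis ab_left_minus add.right_inverse shift_0 shift_shift)

lemma shift_image_iff: "T \<in> shift x ` P \<longleftrightarrow> shift (- x) T \<in> P"
  by (metis (no_types, lifting) imageE imageI shift_minus_eq_iff)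

lemma interior_supp_shift [simp]: "interior (supp (shift x T)) = (+) x ` interior (supp T)"
  by (simp add: interior_translation)

lemma Omega_Union: "Omega A Q D (\<Union>i\<in>I. X i) = (\<Union>i\<in>I. Omega A Q D (X i))"
  by (auto simp: Omega_def)

lemma Omega_shift: "Omega A Q D (shift x ` P) = shift (Q *v x) ` Omega A Q D P"
proof
  show "shift (Q *v x) ` Omega A Q D P \<subseteq> Omega A Q D (shift x ` P)"
  proof (clarsimp simp: Omega_def, intro bexI exI conjI)
    fix T i j u z assume "shift z (prototile A j) \<in> P" "u \<in> D i j"
    show "shift (Q *v x + (u + Q *v z)) (prototile A i) = shift (u + Q *v (x + z)) (prototile A i)"
      by (simp add: matrix_vector_right_distrib algebra_simps)
  qed auto
next
  show "Omega A Q D (shift x ` P) \<subseteq> shift (Q *v x) ` Omega A Q D P"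
  proof
    fix S assume "S \<in> Omega A Q D (shift x ` P)"
    then obtain T i j u z where T: "T \<in> P" "shift x T = shift z (prototile A j)" "u \<in> D i j"
      "S = shift (u + Q *v z) (prototile A i)"
      by (auto simp: Omega_def)
    have "T = shift (z - x) (prototile A j)"
      using T(2) by (metis ab_left_minus diff_conv_add_uminus add.commute shift_0 shift_shift)
    moreover have "S = shift (Q *v x) (shift (u + Q *v (z - x)) (prototile A i))"
      using T(4) by (simp add: matrix_vector_mult_diff_distrib algebra_simps)
    ultimately show "S \<in> shift (Q *v x) ` Omega A Q D P"
      using T unfolding Omega_def by blast
  qed
qed

locale fixed_substitution_tiling =
  fixes A :: "'c::finite \<Rightarrow> (real ^ 'd::finite) set"
    and Q :: "real ^ 'd ^ 'd"
    and D :: "'c \<Rightarrow> 'c \<Rightarrow> (real ^ 'd) set"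
    and \<T> :: "('d, 'c) tile set"
  assumes substitution: "is_substitution A Q D"
    and primitive: "primitive_substitution D"
    and substitution_tiling: "substitution_tiling A Q D \<T>"
    and fixed_point: "Omega A Q D \<T> = \<T>"
    and meyer: "meyer (return_vectors \<T>)"
begin

abbreviation Qpow :: "nat \<Rightarrow> real ^ 'd \<Rightarrow> real ^ 'd" where
  "Qpow k x \<equiv> matpow Q k *v x"

definition infl :: "nat \<Rightarrow> ('d, 'c) tile \<Rightarrow> ('d, 'c) tile set" where
  "infl k T = (Omega A Q D ^^ k) {T}"

text \<open>
  All translates of prototiles, so that the tiles of the translated tilings \<open>\<T> - y\<close> are included.
\<close>

definition tiles :: "('d, 'c) tile set" where
  "tiles = {shift x (prototile A i) | x i. True}"

lemma expansive: "expansive Q"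
  by (rule substitution[unfolded is_substitution_def, THEN conjunct2, THEN conjunct1])

lemma tiling: "tiling A \<T>" using substitution_tiling by (simp add: substitution_tiling_def)

lemma Qpow_diff: "Qpow k (x - y) = Qpow k x - Qpow k y"
  by (rule matrix_vector_mult_diff_distrib)

lemma Qpow_add: "Qpow k (x + y) = Qpow k x + Qpow k y"
  by (rule matrix_vector_right_distrib)

lemma Qpow_minus: "Qpow k (- x) = - Qpow k x"
  by (rule linear_neg[OF matrix_vector_mul_linear])

lemma inj_Qpow: "inj ((*v) (matpow Q k))"
proof (induction k)
  case 0
  then show ?case by (simp add: inj_def)
next
  case (Suc k)
  have "(*v) (matpow Q (Suc k)) = (*v) Q \<circ> (*v) (matpow Q k)"
    by (simp add: fun_eq_iff matpow_Suc_vec)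
  then show ?case using inj_compose[OF expansive_inj[OF expansive] Suc] by (simp only:)
qed

lemma interior_Qpow: "interior ((*v) (matpow Q k) ` S) = (*v) (matpow Q k) ` interior S"
  by (rule interior_injective_linear_image[OF matrix_vector_mul_linear inj_Qpow])

lemma Omega_pow_eq: "(Omega A Q D ^^ k) P = (\<Union>T\<in>P. infl k T)"
  unfolding infl_def by (induction k) (auto simp: Omega_Union)

lemma infl_0 [simp]: "infl 0 T = {T}" by (simp add: infl_def)

lemma infl_Suc: "infl (Suc k) T = Omega A Q D (infl k T)" by (simp add: infl_def)

lemma infl_add: "infl (k + l) T = (\<Union>S\<in>infl k T. infl l S)"
proof -
  have "infl (k + l) T = (Omega A Q D ^^ l) (infl k T)"
    unfolding infl_def add.commute[of k l] by (simp add: funpow_add)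
  then show ?thesis by (simp only: Omega_pow_eq)
qed

lemma infl_addI: "S \<in> infl k T \<Longrightarrow> R \<in> infl l S \<Longrightarrow> R \<in> infl (k + l) T"
  by (auto simp: infl_add)

lemma infl_shift: "infl k (shift x T) = shift (Qpow k x) ` infl k T"
  by (induction k) (simp_all add: infl_Suc Omega_shift matpow_Suc_vec)

lemma infl_shift_iff: "S \<in> infl k (shift x T) \<longleftrightarrow> shift (- Qpow k x) S \<in> infl k T"
  by (simp add: infl_shift shift_image_iff)

lemma Omega_pow_fixed: "(Omega A Q D ^^ k) \<T> = \<T>"
  by (induction k) (auto simp: fixed_point)

lemma Union_infl: "(\<Union>T\<in>\<T>. infl k T) = \<T>"
  using Omega_pow_fixed Omega_pow_eq by metis

lemma infl_in_tiling: "T \<in> \<T> \<Longrightarrow> S \<in> infl k T \<Longrightarrow> S \<in> \<T>"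
  using Union_infl[of k] by blast

lemma tiling_subset_tiles: "\<T> \<subseteq> tiles"
  using tiling by (fastforce simp: tiling_def tiles_def)

lemma shift_tiles [simp]: "shift x T \<in> tiles \<longleftrightarrow> T \<in> tiles"
proof -
  have "shift x T \<in> tiles" if T: "T \<in> tiles" for x T
  proof -
    obtain y i where "T = shift y (prototile A i)" using T by (auto simp: tiles_def)
    then have "shift x T = shift (x + y) (prototile A i)" by simp
    then show ?thesis unfolding tiles_def by blast
  qed
  then show ?thesis by (metis ab_left_minus shift_0 shift_shift)
qed

lemma prototile_tiles [simp]: "prototile A i \<in> tiles"
  unfolding tiles_def by (metis (mono_tags, lifting) mem_Collect_eq shift_0)

lemma infl_in_tiles: "T \<in> tiles \<Longrightarrow> S \<in> infl k T \<Longrightarrow> S \<in> tiles"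
  by (cases k) (auto simp: infl_Suc Omega_def)

lemma cover: "\<exists>T\<in>\<T>. p \<in> supp T"
proof -
  have "(\<Union>T\<in>\<T>. supp T) = UNIV" using tiling by (simp add: tiling_def)
  then show ?thesis by blast
qed

lemma primitive_power: "\<exists>K. \<forall>i j. matpow (\<chi> i j. card (D i j)) K $ i $ j > 0"
  using primitive unfolding primitive_substitution_def by blast

lemma matpow_Suc_pos:
  assumes "matpow (\<chi> i j. card (D i j)) (Suc k) $ i $ j > 0"
  obtains l where "D i l \<noteq> {}" "matpow (\<chi> i j. card (D i j)) k $ l $ j > 0"
proof -
  have "matpow (\<chi> i j. card (D i j)) (Suc k) $ i $ j =
      (\<Sum>l\<in>UNIV. card (D i l) * matpow (\<chi> i j. card (D i j)) k $ l $ j)"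
    by (simp add: matpow_def matrix_matrix_mult_def)
  then have "(\<Sum>l\<in>UNIV. card (D i l) * matpow (\<chi> i j. card (D i j)) k $ l $ j) \<noteq> 0"
    using assms by linarith
  then obtain l where "card (D i l) * matpow (\<chi> i j. card (D i j)) k $ l $ j \<noteq> 0"
    by (rule sum.not_neutral_contains_not_neutral)
  then have "D i l \<noteq> {}" "matpow (\<chi> i j. card (D i j)) k $ l $ j > 0" by auto
  then show thesis by (rule that)
qed

text \<open>
  The entry \<open>(i, j)\<close> of the \<open>k\<close>-th power of the substitution matrix counts the tiles of color \<open>i\<close> in
  the \<open>k\<close>-th inflation of a tile of color \<open>j\<close>.
\<close>

lemma color_in_infl_if_matpow_pos:
  "matpow (\<chi> i j. card (D i j)) k $ i $ j > 0 \<Longrightarrow>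
    \<exists>S\<in>infl k (shift x (prototile A j)). color S = i"
proof (induction k arbitrary: i)
  case 0
  then show ?case by (simp add: matpow_def mat_def prototile_def split: if_splits)
next
  case (Suc k)
  then obtain l where l: "D i l \<noteq> {}" "matpow (\<chi> i j. card (D i j)) k $ l $ j > 0"
    using matpow_Suc_pos by blast
  then obtain S where S: "S \<in> infl k (shift x (prototile A j))" "color S = l"
    using Suc.IH by blast
  have "S \<in> tiles" using S(1) by (rule infl_in_tiles[rotated]) simp
  then obtain z where z: "S = shift z (prototile A l)" using S(2) by (auto simp: tiles_def prototile_def)
  obtain u where "u \<in> D i l" using l by blast
  then have "shift (u + Q *v z) (prototile A i) \<in> infl (Suc k) (shift x (prototile A j))"
    unfolding infl_Suc Omega_def using S z by blast
  then show ?case by (force simp: prototile_def)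
qed

lemma supp_subdivision: "(\<lambda>x. Q *v x) ` A j = (\<Union>i. \<Union>u\<in>D i j. (\<lambda>x. x + u) ` A i)"
  by (rule substitution[unfolded is_substitution_def, THEN conjunct2, THEN conjunct2, THEN conjunct2, THEN conjunct2, THEN conjunct1, THEN spec])

lemma is_tile_prototile: "is_tile (prototile A i)"
  by (rule substitution[unfolded is_substitution_def, THEN conjunct1, THEN spec])

lemma finite_D: "finite (D i j)"
  by (rule substitution[unfolded is_substitution_def, THEN conjunct2, THEN conjunct2, THEN conjunct1, THEN spec, THEN spec])

text \<open>
  The empty set is a tile in the sense of the definition. But \<open>\<T>\<close> covers the space, so some
  prototile is non-empty; and a prototile is non-empty if one of its descendants is, which by
  primitivity applies to all of them.
\<close>

lemma prototile_supp_nonempty: "A i \<noteq> {}"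
proof -
  have step: "A j \<noteq> {} \<Longrightarrow> matpow (\<chi> i j. card (D i j)) k $ j $ i > 0 \<Longrightarrow> A i \<noteq> {}" for k j i
  proof (induction k arbitrary: j)
    case 0
    then show ?case by (simp add: matpow_def mat_def split: if_splits)
  next
    case (Suc k)
    then obtain l where l: "D j l \<noteq> {}" "matpow (\<chi> i j. card (D i j)) k $ l $ i > 0"
      using matpow_Suc_pos by blast
    have "(\<lambda>x. Q *v x) ` A l \<noteq> {}"
      unfolding supp_subdivision using l(1) Suc.prems(1) by auto
    then show ?case using Suc.IH l(2) by blast
  qed
  obtain T where "T \<in> \<T>" "0 \<in> supp T" using cover by blast
  then obtain j where "A j \<noteq> {}" using tiling_subset_tiles by (force simp: tiles_def prototile_def)
  obtain K where "\<forall>i j. matpow (\<chi> i j. card (D i j)) K $ i $ j > 0"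
    using primitive_power by (rule exE)
  then show ?thesis using step[OF \<open>A j \<noteq> {}\<close>] by blast
qed

lemma prototile_compact: "compact (A i)"
  using is_tile_prototile[of i] unfolding is_tile_def prototile_def fst_conv by (rule conjunct1)

lemma prototile_closure_interior: "closure (interior (A i)) = A i"
  using is_tile_prototile[of i] unfolding is_tile_def prototile_def fst_conv
  by (rule conjunct2[THEN sym])

lemma shift_prototile_inject [simp]:
  "shift x (prototile A i) = shift y (prototile A j) \<longleftrightarrow> x = y \<and> i = j"
proof
  assume eq: "shift x (prototile A i) = shift y (prototile A j)"
  have "color (shift x (prototile A i)) = color (shift y (prototile A j))"
    using eq by (rule arg_cong)
  then have ij: "i = j" by (simp add: prototile_def)
  have "supp (shift x (prototile A i)) = supp (shift y (prototile A j))"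
    using eq by (rule arg_cong)
  then have "(+) x ` A i = (+) y ` A i" by (simp only: supp_shift prototile_def fst_conv ij)
  then have "(\<Union>f\<in>{x}. (+) f ` A i) = (\<Union>f\<in>{y}. (+) f ` A i)" by simp
  then have "{x} \<inter> {y} \<noteq> {}"
    by (rule common_translate_of_equal_unions[OF prototile_compact prototile_supp_nonempty, rotated -1])
      simp_all
  then show "x = y \<and> i = j" using ij by simp
qed simp

lemma Omega_prototile:
  "Omega A Q D {shift x (prototile A j)} = {shift (u + Q *v x) (prototile A i) | i u. u \<in> D i j}"
proof -
  have "Omega A Q D {shift x (prototile A j)} =
      {shift (u + Q *v x') (prototile A i) | i j' u x'.
        shift x (prototile A j) = shift x' (prototile A j') \<and> u \<in> D i j'}"
    unfolding Omega_def by simp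
  also have "\<dots> = {shift (u + Q *v x) (prototile A i) | i u. u \<in> D i j}"
    unfolding shift_prototile_inject by blast
  finally show ?thesis .
qed

lemma finite_infl: "T \<in> tiles \<Longrightarrow> finite (infl k T)"
proof (induction k)
  case (Suc k)
  have fin: "finite (Omega A Q D {S})" if tile: "S \<in> tiles" for S
  proof -
    obtain x j where S: "S = shift x (prototile A j)" using tile unfolding tiles_def by blast
    have "Omega A Q D {S} = (\<Union>i. (\<lambda>u. shift (u + Q *v x) (prototile A i)) ` D i j)"
      unfolding S Omega_prototile by auto
    then show ?thesis using finite_D by simp
  qed
  have "infl (Suc k) T = (\<Union>S\<in>infl k T. Omega A Q D {S})"
    unfolding infl_Suc by (auto simp: Omega_def)
  then show ?case using Suc fin infl_in_tiles by simp
qed simp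

lemma supp_Omega: "S \<in> tiles \<Longrightarrow> (\<Union>R\<in>Omega A Q D {S}. supp R) = (*v) Q ` supp S"
proof -
  assume "S \<in> tiles"
  then obtain x j where S: "S = shift x (prototile A j)" unfolding tiles_def by blast
  have "(\<Union>R\<in>Omega A Q D {S}. supp R) = (\<Union>i. \<Union>u\<in>D i j. supp (shift (u + Q *v x) (prototile A i)))"
    unfolding S Omega_prototile by blast
  also have "\<dots> = (\<Union>i. \<Union>u\<in>D i j. (+) (Q *v x) ` (\<lambda>x. x + u) ` A i)"
    by (simp add: prototile_def image_image ac_simps)
  also have "\<dots> = (+) (Q *v x) ` (\<Union>i. \<Union>u\<in>D i j. (\<lambda>x. x + u) ` A i)"
    by (simp only: image_UN)
  also have "\<dots> = (*v) Q ` supp S"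
    unfolding supp_subdivision[symmetric] S
    by (simp add: image_image prototile_def matrix_vector_right_distrib)
  finally show ?thesis .
qed

lemma supp_infl: "T \<in> tiles \<Longrightarrow> (\<Union>S\<in>infl k T. supp S) = (*v) (matpow Q k) ` supp T"
proof (induction k)
  case (Suc k)
  have "(\<Union>S\<in>infl (Suc k) T. supp S) = (\<Union>S\<in>infl k T. \<Union>R\<in>Omega A Q D {S}. supp R)"
    unfolding infl_Suc by (auto simp: Omega_def)
  also have "\<dots> = (\<Union>S\<in>infl k T. (*v) Q ` supp S)"
    using Suc.prems supp_Omega infl_in_tiles by simp
  also have "\<dots> = (*v) Q ` (\<Union>S\<in>infl k T. supp S)" by blast
  also have "\<dots> = (*v) (matpow Q (Suc k)) ` supp T"
    unfolding Suc.IH[OF Suc.prems] by (simp add: image_image matpow_Suc_vec)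
  finally show ?case .
qed (simp add: image_def)

lemma infl_supp_subset: "T \<in> tiles \<Longrightarrow> S \<in> infl k T \<Longrightarrow> supp S \<subseteq> (*v) (matpow Q k) ` supp T"
  using supp_infl by blast

lemma tile_compact: "T \<in> tiles \<Longrightarrow> compact (supp T)"
  by (auto simp: tiles_def prototile_def prototile_compact compact_translation)

lemma tile_closed: "T \<in> tiles \<Longrightarrow> closed (supp T)"
  using tile_compact compact_imp_closed by blast

lemma tile_closure_interior: "T \<in> tiles \<Longrightarrow> closure (interior (supp T)) = supp T"
  by (auto simp: tiles_def prototile_def closure_translation interior_translation prototile_closure_interior)

lemma tile_nonempty: "T \<in> tiles \<Longrightarrow> supp T \<noteq> {}"
  by (auto simp: tiles_def prototile_def prototile_supp_nonempty)

lemma tile_interior_nonempty: "T \<in> tiles \<Longrightarrow> interior (supp T) \<noteq> {}"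
  using tile_closure_interior[of T] tile_nonempty[of T] by auto

text \<open>
  A tile is the closure of its interior. This turns the covering by supports into statements about
  interiors.
\<close>

lemma open_meets_interior:
  assumes "T \<in> tiles" "open X" "p \<in> X" "p \<in> supp T"
  shows "X \<inter> interior (supp T) \<noteq> {}"
proof -
  have "X \<inter> closure (interior (supp T)) \<noteq> {}" using assms tile_closure_interior by auto
  then show ?thesis unfolding open_Int_closure_eq_empty[OF assms(2)] .
qed

lemma infl_nonempty: "T \<in> tiles \<Longrightarrow> infl k T \<noteq> {}"
  using supp_infl[of T k] tile_nonempty[of T] by auto

lemma tile_diameter:
  obtains \<delta> where "\<delta> > 0" "\<And>T x y. T \<in> tiles \<Longrightarrow> x \<in> supp T \<Longrightarrow> y \<in> supp T \<Longrightarrow> dist x y \<le> \<delta>"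
proof -
  have "bounded (\<Union>i. A i)" by (intro bounded_UN) (auto intro: compact_imp_bounded prototile_compact)
  then obtain a where a: "\<And>x i. x \<in> A i \<Longrightarrow> norm x \<le> a" unfolding bounded_iff by blast
  have "dist x y \<le> 2 * \<bar>a\<bar> + 1" if T: "T \<in> tiles" "x \<in> supp T" "y \<in> supp T" for T x y
  proof -
    obtain z i p q where "x = z + p" "y = z + q" "p \<in> A i" "q \<in> A i"
      using T by (auto simp: tiles_def prototile_def)
    then have "dist x y = norm (p - q)" "norm p \<le> a" "norm q \<le> a"
      using a by (auto simp: dist_norm)
    then show ?thesis using norm_triangle_ineq4[of p q] by linarith
  qed
  then show thesis using that[of "2 * \<bar>a\<bar> + 1"] by simp
qed

lemma tile_eq_shift_prototile:
  assumes "T \<in> tiles"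
  obtains x where "T = shift x (prototile A (color T))"
proof -
  obtain x i where "T = shift x (prototile A i)" using assms unfolding tiles_def by blast
  moreover from this have c: "color T = i" by (simp add: prototile_def)
  ultimately have "T = shift x (prototile A (color T))" unfolding c by blast
  then show thesis by (rule that)
qed

lemma all_colors_in_infl: "\<exists>K. \<forall>k\<ge>K. \<forall>T\<in>tiles. \<forall>i. \<exists>S\<in>infl k T. color S = i"
proof -
  obtain K where K: "\<forall>i j. matpow (\<chi> i j. card (D i j)) K $ i $ j > 0"
    using primitive_power by (rule exE)
  have "\<exists>S\<in>infl k T. color S = i" if k: "k \<ge> K" and T: "T \<in> tiles" for k T i
  proof -
    obtain R where R: "R \<in> infl (k - K) T" using infl_nonempty[OF T] by blast
    then have "R \<in> tiles" using infl_in_tiles T by blast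
    then obtain x where "R = shift x (prototile A (color R))" by (rule tile_eq_shift_prototile)
    then obtain S where S: "S \<in> infl K R" "color S = i"
      using color_in_infl_if_matpow_pos[where x = x and i = i and j = "color R", OF K[rule_format]] by auto
    then show ?thesis using infl_addI[OF R S(1)] k by auto
  qed
  then show ?thesis by blast
qed

lemma tile_of_color: "\<exists>T\<in>\<T>. color T = i"
proof -
  obtain T where T: "T \<in> \<T>" using cover by blast
  obtain K where "\<forall>k\<ge>K. \<forall>T\<in>tiles. \<forall>i. \<exists>S\<in>infl k T. color S = i"
    using all_colors_in_infl by (rule exE)
  then obtain S where "S \<in> infl K T" "color S = i" using T tiling_subset_tiles by blast
  then show ?thesis using infl_in_tiling[OF T] by blast
qed

lemma surj_Qpow: "\<exists>x. p = Qpow k x"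
  using linear_inj_imp_surj[OF matrix_vector_mul_linear inj_Qpow[of k]] by (rule surjD)

text \<open>
  The diameters of tiles are bounded, whereas \<open>Q\<^sup>k\<close> stretches all distances by arbitrarily large
  factors.
\<close>

lemma tiles_near_inflated_point:
  assumes "\<epsilon> > 0"
  shows "\<exists>k0. \<forall>k\<ge>k0. \<forall>T\<in>tiles. supp T \<inter> Qpow k ` ball q \<epsilon> \<noteq> {} \<longrightarrow>
    supp T \<subseteq> Qpow k ` ball q (2 * \<epsilon>)"
proof -
  obtain \<delta> where \<delta>: "\<delta> > 0" "\<And>T x y. T \<in> tiles \<Longrightarrow> x \<in> supp T \<Longrightarrow> y \<in> supp T \<Longrightarrow> dist x y \<le> \<delta>"
    using tile_diameter by blast
  have "\<epsilon> / \<delta> > 0" using assms \<delta>(1) by simp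
  then obtain k0 where k0: "\<And>k x. k \<ge> k0 \<Longrightarrow> norm x \<le> \<epsilon> / \<delta> * norm (Qpow k x)"
    using expansive_powers_expand[OF expansive] by blast
  have "supp T \<subseteq> Qpow k ` ball q (2 * \<epsilon>)"
    if k: "k \<ge> k0" and T: "T \<in> tiles" and meets: "supp T \<inter> Qpow k ` ball q \<epsilon> \<noteq> {}" for k T
  proof
    fix p assume p: "p \<in> supp T"
    obtain x0 where x0: "Qpow k x0 \<in> supp T" "dist q x0 < \<epsilon>" using meets by auto
    obtain x where x: "p = Qpow k x" using surj_Qpow by blast
    have "norm (x - x0) \<le> \<epsilon> / \<delta> * norm (Qpow k (x - x0))" by (rule k0[OF k])
    also have "norm (Qpow k (x - x0)) = dist p (Qpow k x0)" by (simp add: Qpow_diff x dist_norm)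
    also have "\<epsilon> / \<delta> * dist p (Qpow k x0) \<le> \<epsilon> / \<delta> * \<delta>"
      using \<delta>(2)[OF T p x0(1)] assms \<delta>(1) by (intro mult_left_mono) auto
    finally have "dist x0 x \<le> \<epsilon>" using \<delta>(1) by (simp add: dist_norm norm_minus_commute)
    then have "dist q x < 2 * \<epsilon>" using x0(2) dist_triangle[of q x x0] by linarith
    then show "p \<in> Qpow k ` ball q (2 * \<epsilon>)" using x by auto
  qed
  then show ?thesis by blast
qed

lemma eq_if_bounded_orbit:
  assumes "\<And>k. \<exists>m\<ge>k. norm (Qpow m (x - y)) \<le> b"
  shows "x = y"
proof (rule ccontr)
  assume "x \<noteq> y"
  then have pos: "norm (x - y) > 0" by simp
  define \<eta> where "\<eta> = norm (x - y) / (2 * (\<bar>b\<bar> + 1))"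
  have "\<eta> > 0" using pos by (simp add: \<eta>_def)
  then obtain k0 where k0: "\<And>k x. k \<ge> k0 \<Longrightarrow> norm x \<le> \<eta> * norm (Qpow k x)"
    using expansive_powers_expand[OF expansive] by blast
  obtain m where m: "m \<ge> k0" "norm (Qpow m (x - y)) \<le> b" using assms by blast
  have "norm (x - y) \<le> \<eta> * norm (Qpow m (x - y))" by (rule k0[OF m(1)])
  also have "\<dots> \<le> \<eta> * (\<bar>b\<bar> + 1)" using m(2) \<open>\<eta> > 0\<close> by (intro mult_left_mono) auto
  also have "\<dots> = norm (x - y) / 2" by (simp add: \<eta>_def field_simps)
  finally show False using pos by linarith
qed

section \<open>Overlaps as pairs of tiles\<close>

definition return_vecs :: "(real ^ 'd) set" where "return_vecs = return_vectors \<T>"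

lemma return_vecs_iff: "y \<in> return_vecs \<longleftrightarrow> (\<exists>U\<in>\<T>. shift y U \<in> \<T>)"
proof -
  have eq: "U = shift (- y) V \<longleftrightarrow> shift y U = V" for U V :: "('d, 'c) tile" by auto
  show ?thesis unfolding return_vecs_def return_vectors_def mem_Collect_eq eq by simp
qed

lemma zero_return_vecs: "0 \<in> return_vecs"
  unfolding return_vecs_iff using cover[of 0] by auto

lemma return_vecs_Qpow:
  assumes "y \<in> return_vecs" shows "Qpow k y \<in> return_vecs"
proof -
  obtain U where U: "U \<in> \<T>" "shift y U \<in> \<T>" using assms return_vecs_iff by blast
  obtain S where S: "S \<in> infl k U" using infl_nonempty U tiling_subset_tiles by blast
  then have "shift (Qpow k y) S \<in> infl k (shift y U)" by (simp add: infl_shift)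
  then show ?thesis using infl_in_tiling U S return_vecs_iff by blast
qed

definition translated :: "('d, 'c) tile \<Rightarrow> bool" where
  "translated W \<longleftrightarrow> (\<exists>y\<in>return_vecs. shift y W \<in> \<T>)"

text \<open>
  The overlap \<open>(U, y, V)\<close>, represented by the two tiles \<open>U\<close> and \<open>W = V - y\<close> that do overlap. In this
  form the descendants of an overlap are pairs of tiles of the inflations, without any reference to
  the inflated return vector.
\<close>

definition overlap_pair :: "('d, 'c) tile \<Rightarrow> ('d, 'c) tile \<Rightarrow> bool" where
  "overlap_pair U W \<longleftrightarrow>
     U \<in> \<T> \<and> translated W \<and> interior (supp U) \<inter> interior (supp W) \<noteq> {}"

lemma translated_in_tiles:
  assumes "translated W" shows "W \<in> tiles"
proof -
  obtain y where "shift y W \<in> \<T>" using assms unfolding translated_def by blast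
  then have "shift y W \<in> tiles" using tiling_subset_tiles by blast
  then show ?thesis by simp
qed

lemma tiling_translated: "U \<in> \<T> \<Longrightarrow> translated U"
  unfolding translated_def by (rule bexI[OF _ zero_return_vecs]) simp

lemma translated_infl:
  assumes "translated W" "W' \<in> infl k W" shows "translated W'"
proof -
  obtain y where y: "y \<in> return_vecs" "shift y W \<in> \<T>" using assms(1) unfolding translated_def by blast
  have "shift (Qpow k y) W' \<in> infl k (shift y W)" using assms(2) by (simp add: infl_shift)
  then show ?thesis unfolding translated_def using infl_in_tiling[OF y(2)] return_vecs_Qpow[OF y(1)] by blast
qed

lemma overlap_pair_tiles: "overlap_pair U W \<Longrightarrow> U \<in> tiles" "overlap_pair U W \<Longrightarrow> W \<in> tiles"
  unfolding overlap_pair_def using tiling_subset_tiles translated_in_tiles by blast+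

lemma overlap_pair_infl:
  assumes "overlap_pair U W" "U' \<in> infl k U" "W' \<in> infl k W"
    "interior (supp U') \<inter> interior (supp W') \<noteq> {}"
  shows "overlap_pair U' W'"
  using assms infl_in_tiling translated_infl unfolding overlap_pair_def by blast

lemma open_meets_infl:
  assumes "T \<in> tiles" "open X" "X \<noteq> {}" "X \<subseteq> Qpow k ` supp T"
  obtains S where "S \<in> infl k T" "X \<inter> interior (supp S) \<noteq> {}"
proof -
  obtain p where p: "p \<in> X" using assms(3) by blast
  then have "p \<in> (\<Union>S\<in>infl k T. supp S)" unfolding supp_infl[OF assms(1)] by (rule subsetD[OF assms(4)])
  then obtain S where S: "S \<in> infl k T" "p \<in> supp S" by blast
  then have "X \<inter> interior (supp S) \<noteq> {}"
    using open_meets_interior[OF infl_in_tiles[OF assms(1)] assms(2) p] by blast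
  then show thesis using S(1) that by blast
qed

lemma infl_interiors_meet:
  assumes "U \<in> tiles" "W \<in> tiles" "interior (supp U) \<inter> interior (supp W) \<noteq> {}"
  obtains U' W' where "U' \<in> infl k U" "W' \<in> infl k W" "interior (supp U') \<inter> interior (supp W') \<noteq> {}"
proof -
  let ?X = "Qpow k ` interior (supp U) \<inter> Qpow k ` interior (supp W)"
  have X: "open ?X" unfolding interior_Qpow[symmetric] by (intro open_Int open_interior)
  have ne: "?X \<noteq> {}" using assms(3) by blast
  have "?X \<subseteq> Qpow k ` supp U" using interior_subset by blast
  then obtain U' where U': "U' \<in> infl k U" "?X \<inter> interior (supp U') \<noteq> {}"
    using open_meets_infl[OF assms(1) X ne] by blast
  have "?X \<inter> interior (supp U') \<subseteq> Qpow k ` supp W" using interior_subset by blast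
  then obtain W' where W': "W' \<in> infl k W" "?X \<inter> interior (supp U') \<inter> interior (supp W') \<noteq> {}"
    using open_meets_infl[OF assms(2) open_Int[OF X open_interior] U'(2)] by blast
  then show thesis using that[OF U'(1) W'(1)] by blast
qed

lemma coincidence_mono:
  assumes "infl k U \<inter> infl k W \<noteq> {}" "U \<in> tiles" "k \<le> l"
  shows "infl l U \<inter> infl l W \<noteq> {}"
proof -
  obtain S where S: "S \<in> infl k U" "S \<in> infl k W" using assms(1) by blast
  obtain R where "R \<in> infl (l - k) S" using infl_nonempty infl_in_tiles[OF assms(2) S(1)] by blast
  then have "R \<in> infl (k + (l - k)) U" "R \<in> infl (k + (l - k)) W" using S infl_addI by blast+
  then show ?thesis using assms(3) by auto
qed

text \<open>
  A tile \<open>S\<close> in both inflations corresponds to the coincidence \<open>(S, Q\<^sup>l y, S + Q\<^sup>l y)\<close>, which is an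
  overlap because the interior of \<open>S\<close> is not empty.
\<close>

lemma overlap_coincidence_iff:
  "overlap_coincidence A Q D \<T> \<longleftrightarrow>
    (\<exists>l>0. \<forall>U W. overlap_pair U W \<longrightarrow> infl l U \<inter> infl l W \<noteq> {})"
  (is "?L \<longleftrightarrow> ?R")
proof
  assume ?L
  then obtain l where l: "l > 0"
    "\<forall>O1\<in>overlaps \<T>. \<exists>O2\<in>inflate_overlap A Q D \<T> l O1. coincidence O2"
    unfolding overlap_coincidence_def by blast
  have "infl l U \<inter> infl l W \<noteq> {}" if pair: "overlap_pair U W" for U W
  proof -
    obtain y where y: "y \<in> return_vecs" "shift y W \<in> \<T>"
      using pair unfolding overlap_pair_def translated_def by blast
    have "(U, y, shift y W) \<in> overlaps \<T>"
      using pair y unfolding overlaps_def overlap_pair_def return_vecs_def mem_Collect_eq prod.case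
        shift_shift by simp
    then obtain O2 where "O2 \<in> inflate_overlap A Q D \<T> l (U, y, shift y W)" "coincidence O2"
      using l(2) by blast
    then obtain U' V' where "U' \<in> infl l U" "V' \<in> infl l (shift y W)" "U' = shift (- Qpow l y) V'"
      unfolding inflate_overlap_def coincidence_def by (auto simp flip: infl_def)
    then have "U' \<in> infl l U \<inter> infl l W" by (simp add: infl_shift_iff)
    then show ?thesis by blast
  qed
  then show ?R using l(1) by blast
next
  assume ?R
  then obtain l where l: "l > 0" "\<And>U W. overlap_pair U W \<Longrightarrow> infl l U \<inter> infl l W \<noteq> {}" by blast
  have "\<exists>O2\<in>inflate_overlap A Q D \<T> l O1. coincidence O2" if O1: "O1 \<in> overlaps \<T>" for O1
  proof -
    obtain U y V where UV: "O1 = (U, y, V)" "U \<in> \<T>" "V \<in> \<T>" "y \<in> return_vecs"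
      "interior (supp U) \<inter> interior (supp (shift (- y) V)) \<noteq> {}"
      using O1 unfolding overlaps_def return_vecs_def by blast
    let ?W = "shift (- y) V"
    have "shift y ?W \<in> \<T>" using UV(3) by simp
    then have "overlap_pair U ?W"
      using UV unfolding overlap_pair_def translated_def by blast
    then obtain S where S: "S \<in> infl l U" "S \<in> infl l ?W" using l(2) by blast
    let ?V' = "shift (Qpow l y) S"
    have V': "?V' \<in> infl l V" using S(2) by (simp add: infl_shift_iff Qpow_minus)
    have S\<T>: "S \<in> \<T>" "?V' \<in> \<T>" using infl_in_tiling UV S V' by blast+
    have "interior (supp S) \<noteq> {}" using S\<T>(1) tile_interior_nonempty tiling_subset_tiles by blast
    then have "(S, Qpow l y, ?V') \<in> overlaps \<T>"
      using S\<T> return_vecs_Qpow[OF UV(4)] unfolding overlaps_def return_vecs_def mem_Collect_eq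
        prod.case shift_shift by simp
    then have "(S, Qpow l y, ?V') \<in> inflate_overlap A Q D \<T> l O1"
      using S(1) V' unfolding inflate_overlap_def UV(1) prod.case infl_def[symmetric]
      by blast
    moreover have "coincidence (S, Qpow l y, ?V')" unfolding coincidence_def by simp
    ultimately show ?thesis by blast
  qed
  then show ?L unfolding overlap_coincidence_def using l(1) by blast
qed

text \<open>
  A reference point for comparing tiles of equal color; it involves no tile map.
\<close>

definition position :: "('d, 'c) tile \<Rightarrow> real ^ 'd" where
  "position T = (THE x. T = shift x (prototile A (color T)))"

lemma color_prototile [simp]: "color (prototile A i) = i"
  by (simp add: prototile_def)

lemma position_prototile [simp]: "position (shift x (prototile A i)) = x"
  unfolding position_def by simp

lemma shift_position: "T \<in> tiles \<Longrightarrow> shift (position T) (prototile A (color T)) = T"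
proof -
  assume "T \<in> tiles"
  then obtain x i where "T = shift x (prototile A i)" unfolding tiles_def by blast
  then show ?thesis by simp
qed

lemma position_shift: "T \<in> tiles \<Longrightarrow> position (shift x T) = x + position T"
proof -
  assume "T \<in> tiles"
  then obtain y i where "T = shift y (prototile A i)" unfolding tiles_def by blast
  then show ?thesis by simp
qed

lemma tile_eqI:
  assumes "S \<in> tiles" "T \<in> tiles" "color S = color T" "position S = position T"
  shows "S = T"
proof -
  have "S = shift (position T) (prototile A (color T))"
    using shift_position[OF assms(1)] unfolding assms(3,4) by (rule sym)
  then show ?thesis unfolding shift_position[OF assms(2)] .
qed

lemma same_color_return_vec:
  assumes "S \<in> \<T>" "T \<in> \<T>" "color S = color T"
  shows "position S - position T \<in> return_vecs" "S = shift (position S - position T) T"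
proof -
  have t: "S \<in> tiles" "T \<in> tiles" using assms tiling_subset_tiles by blast+
  then show "S = shift (position S - position T) T"
    using assms(3) by (intro tile_eqI) (auto simp: position_shift)
  then show "position S - position T \<in> return_vecs"
    unfolding return_vecs_iff using assms(1,2) by (intro bexI[of _ T]) simp_all
qed

lemma uniform_discrete_diff_return_vecs: "uniform_discrete (diff_set return_vecs)"
  using meyer unfolding meyer_def return_vecs_def by blast

lemma diff_setI: "x \<in> X \<Longrightarrow> y \<in> X \<Longrightarrow> x - y \<in> diff_set X"
  unfolding diff_set_def by blast

lemma prototile_bound: "\<exists>a>0. \<forall>T\<in>tiles. \<forall>p\<in>supp T. norm (p - position T) \<le> a"
proof -
  have "bounded (\<Union>i. A i)"
    by (intro bounded_UN) (auto intro: compact_imp_bounded prototile_compact)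
  then obtain a where a: "a > 0" "\<And>x i. x \<in> A i \<Longrightarrow> norm x \<le> a" unfolding bounded_pos by blast
  have "norm (p - position T) \<le> a" if T: "T \<in> tiles" and p: "p \<in> supp T" for T p
  proof -
    have "p \<in> supp (shift (position T) (prototile A (color T)))" using shift_position[OF T] p by simp
    then obtain b where "b \<in> A (color T)" "p = position T + b" by (auto simp: prototile_def)
    then show ?thesis using a(2) by simp
  qed
  then show ?thesis using a(1) by blast
qed

text \<open>
  Compared with a fixed tile of \<open>\<T>\<close> of the same color, the position of \<open>W\<close> is a difference of two
  return vectors, and these differences are uniformly discrete by the Meyer property.
\<close>

lemma translated_locally_finite:
  assumes "bounded B"
  shows "finite {W. translated W \<and> supp W \<inter> B \<noteq> {}}"
proof -
  obtain a where a: "a > 0" "\<And>T p. T \<in> tiles \<Longrightarrow> p \<in> supp T \<Longrightarrow> norm (p - position T) \<le> a"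
    using prototile_bound by blast
  obtain b where b: "\<And>p. p \<in> B \<Longrightarrow> norm p \<le> b" using assms unfolding bounded_iff by blast
  obtain T0 where T0: "\<And>i. T0 i \<in> \<T>" "\<And>i. color (T0 i) = i" using tile_of_color by metis
  let ?X = "\<lambda>i. diff_set return_vecs \<inter> cball (- position (T0 i)) (a + b)"
  let ?f = "\<lambda>(i, v). shift (position (T0 i) + v) (prototile A i)"
  have "{W. translated W \<and> supp W \<inter> B \<noteq> {}} \<subseteq> ?f ` (SIGMA i : UNIV. ?X i)"
  proof (intro subsetI, elim CollectE conjE)
    fix W assume W: "translated W" "supp W \<inter> B \<noteq> {}"
    let ?i = "color W"
    let ?v = "position W - position (T0 ?i)"
    have t: "W \<in> tiles" by (rule translated_in_tiles[OF W(1)])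
    obtain y where y: "y \<in> return_vecs" "shift y W \<in> \<T>" using W unfolding translated_def by blast
    have "y + position W - position (T0 ?i) \<in> return_vecs"
      using same_color_return_vec(1)[OF y(2) T0(1)[of ?i]] T0(2)[of ?i] position_shift[OF t] by simp
    then have "(y + position W - position (T0 ?i)) - y \<in> diff_set return_vecs"
      using y(1) by (rule diff_setI)
    then have v: "?v \<in> diff_set return_vecs" by (simp add: algebra_simps)
    obtain p where p: "p \<in> supp W" "norm p \<le> b" using W(2) b by blast
    have "norm (position W) \<le> a + b"
      using a(2)[OF t p(1)] p(2) norm_triangle_ineq4[of p "p - position W"] by simp
    then have "?v \<in> cball (- position (T0 ?i)) (a + b)" by (simp add: dist_norm)
    then have "(?i, ?v) \<in> (SIGMA i : UNIV. ?X i)" using v by simp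
    moreover have "W = ?f (?i, ?v)" using shift_position[OF t] by simp
    ultimately show "W \<in> ?f ` (SIGMA i : UNIV. ?X i)" by blast
  qed
  moreover have "finite (SIGMA i : (UNIV :: 'c set). ?X i)"
    using uniform_discrete_finite_Int_bounded[OF uniform_discrete_diff_return_vecs bounded_cball]
    by (intro finite_SigmaI) auto
  ultimately show ?thesis using finite_surj by blast
qed

text \<open>
  A complete invariant of a pair of tiles up to a common translation.
\<close>

definition pair_class :: "('d, 'c) tile \<times> ('d, 'c) tile \<Rightarrow> 'c \<times> 'c \<times> (real ^ 'd)" where
  "pair_class p = (color (fst p), color (snd p), position (snd p) - position (fst p))"

lemma pair_class_eqD:
  assumes "pair_class (U, W) = pair_class (U', W')" "U \<in> tiles" "W \<in> tiles" "U' \<in> tiles" "W' \<in> tiles"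
  shows "\<exists>z. U' = shift z U \<and> W' = shift z W"
proof -
  let ?z = "position U' - position U"
  have "position W' = ?z + position W" using assms(1) by (simp add: pair_class_def algebra_simps)
  then have "U' = shift ?z U \<and> W' = shift ?z W"
    using assms by (auto intro!: tile_eqI simp: position_shift pair_class_def)
  then show ?thesis by blast
qed

text \<open>
  The tiles \<open>U\<close> and \<open>W\<close> may have different colors, and then the vector from one to the other is not
  directly a difference of return vectors. So \<open>U\<close> is first replaced by a tile \<open>S\<close> of the color of
  \<open>W\<close> that lies in the same inflated tile \<open>\<Omega>\<^sup>K P\<close>. The step from \<open>U\<close> to \<open>S\<close> has finitely many
  values, and the step from \<open>S\<close> to \<open>W\<close> is a bounded difference of two return vectors, which again
  has finitely many values.
\<close>

lemma finite_pair_classes: "finite {pair_class (U, W) | U W. overlap_pair U W}"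
proof -
  obtain K where K: "\<forall>k\<ge>K. \<forall>T\<in>tiles. \<forall>i. \<exists>S\<in>infl k T. color S = i"
    using all_colors_in_infl by (rule exE)
  obtain a where a: "a > 0" "\<And>T p. T \<in> tiles \<Longrightarrow> p \<in> supp T \<Longrightarrow> norm (p - position T) \<le> a"
    using prototile_bound by blast
  define G where "G = (\<Union>c. (\<lambda>(S, R). position S - position R) `
     (infl K (prototile A c) \<times> infl K (prototile A c)))"
  have finG: "finite G" unfolding G_def using finite_infl by auto
  then obtain g where g: "\<And>x. x \<in> G \<Longrightarrow> norm x \<le> g"
    using finite_imp_bounded[OF finG] unfolding bounded_iff by blast
  define X where "X = diff_set return_vecs \<inter> cball 0 (a + a + g)"
  have finX: "finite X" unfolding X_def
    by (rule uniform_discrete_finite_Int_bounded[OF uniform_discrete_diff_return_vecs bounded_cball])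
  have "position W - position U \<in> (\<lambda>(x, y). x + y) ` (X \<times> G)" if pair: "overlap_pair U W" for U W
  proof -
    have t: "U \<in> tiles" "W \<in> tiles" and U: "U \<in> \<T>"
      using pair overlap_pair_tiles overlap_pair_def by blast+
    obtain y where y: "y \<in> return_vecs" "shift y W \<in> \<T>"
      using pair unfolding overlap_pair_def translated_def by blast
    obtain P where P: "P \<in> \<T>" "U \<in> infl K P" using Union_infl[of K] U by blast
    then have Pt: "P \<in> tiles" using tiling_subset_tiles by blast
    then obtain S where S: "S \<in> infl K P" "color S = color W" using K by blast
    have S\<T>: "S \<in> \<T>" "S \<in> tiles" using infl_in_tiling[OF P(1) S(1)] infl_in_tiles[OF Pt S(1)] by auto
    obtain z where z: "P = shift z (prototile A (color P))" using tile_eq_shift_prototile[OF Pt] .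
    let ?sh = "shift (- Qpow K z)"
    have "?sh S \<in> infl K (prototile A (color P))"
      using S(1) infl_shift_iff[of S K z "prototile A (color P)"] by (simp flip: z)
    moreover have "?sh U \<in> infl K (prototile A (color P))"
      using P(2) infl_shift_iff[of U K z "prototile A (color P)"] by (simp flip: z)
    ultimately have "position (?sh S) - position (?sh U) \<in> G" unfolding G_def by force
    then have G: "position S - position U \<in> G" by (simp add: position_shift t S\<T>)
    have "y + position W - position S \<in> return_vecs"
      using same_color_return_vec(1)[OF y(2) S\<T>(1)] S(2) position_shift[OF t(2)] by simp
    then have "(y + position W - position S) - y \<in> diff_set return_vecs"
      using y(1) by (rule diff_setI)
    then have d: "position W - position S \<in> diff_set return_vecs" by (simp add: algebra_simps)
    obtain p where p: "p \<in> supp U" "p \<in> supp W"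
      using pair interior_subset unfolding overlap_pair_def by blast
    have "norm (position W - position S) =
        norm ((p - position U) - (p - position W) - (position S - position U))"
      by (rule arg_cong) simp
    then have "norm (position W - position S) \<le> a + a + g"
      using a(2)[OF t(1) p(1)] a(2)[OF t(2) p(2)] g[OF G]
        norm_triangle_ineq4[of "(p - position U) - (p - position W)" "position S - position U"]
        norm_triangle_ineq4[of "p - position U" "p - position W"] by linarith
    then have "position W - position S \<in> X" using d unfolding X_def by simp
    then show ?thesis using G by force
  qed
  then have "{pair_class (U, W) | U W. overlap_pair U W} \<subseteq>
      UNIV \<times> UNIV \<times> (\<lambda>(x, y). x + y) ` (X \<times> G)"
    unfolding pair_class_def by auto
  moreover have "finite ((UNIV :: 'c set) \<times> (UNIV :: 'c set) \<times> (\<lambda>(x, y). x + y) ` (X \<times> G))"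
    using finX finG by simp
  ultimately show ?thesis using finite_subset by blast
qed

section \<open>Algebraic coincidence\<close>

text \<open>
  The vectors are treated one after the other. The tile found so far overlaps some tile of
  \<open>\<T> - Q\<^sup>k y\<close>, and a coincidence of the two is a descendant that belongs to both tilings. What has
  been achieved for the earlier vectors is inherited by descendants.
\<close>

lemma common_coincidence_finite:
  assumes oc: "\<And>U W. overlap_pair U W \<Longrightarrow> infl l U \<inter> infl l W \<noteq> {}"
    and "finite F" "F \<subseteq> return_vecs" "T \<in> \<T>"
  shows "\<exists>k. \<exists>S\<in>infl k T. \<forall>y\<in>F. shift (Qpow k y) S \<in> \<T>"
  using assms(2,3)
proof (induction F rule: finite_induct)
  case empty
  show ?case by (intro exI[of _ 0] bexI[of _ T]) auto
next
  case (insert y F)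
  then obtain k S where S: "S \<in> infl k T" "\<And>x. x \<in> F \<Longrightarrow> shift (Qpow k x) S \<in> \<T>" by blast
  have S\<T>: "S \<in> \<T>" by (rule infl_in_tiling[OF assms(4) S(1)])
  then have t: "S \<in> tiles" using tiling_subset_tiles by blast
  have y: "Qpow k y \<in> return_vecs" using insert.prems return_vecs_Qpow by blast
  obtain p where p: "p \<in> interior (supp S)" using tile_interior_nonempty[OF t] by blast
  obtain V where V: "V \<in> \<T>" "Qpow k y + p \<in> supp V" using cover by blast
  define W where "W = shift (- Qpow k y) V"
  have V': "V = shift (Qpow k y) W" by (simp add: W_def)
  then have trans: "translated W" unfolding translated_def using y V(1) by blast
  have "p \<in> supp W" using V(2) unfolding V' supp_shift by auto
  then have "interior (supp S) \<inter> interior (supp W) \<noteq> {}"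
    using open_meets_interior[OF translated_in_tiles[OF trans] open_interior p] by blast
  then have "overlap_pair S W" unfolding overlap_pair_def using S\<T> trans by blast
  then obtain R where R: "R \<in> infl l S" "R \<in> infl l W" using oc by blast
  have "shift (Qpow (k + l) x) R \<in> \<T>" if x: "x \<in> F" for x
  proof -
    have "shift (Qpow l (Qpow k x)) R \<in> infl l (shift (Qpow k x) S)" using R(1) by (simp add: infl_shift)
    then show ?thesis using infl_in_tiling[OF S(2)[OF x]]
      by (simp add: add.commute[of k l] matpow_add_vec)
  qed
  moreover have "shift (Qpow (k + l) y) R \<in> \<T>"
  proof -
    have "shift (Qpow l (Qpow k y)) R \<in> infl l V" unfolding V' using R(2) by (simp add: infl_shift)
    then show ?thesis using infl_in_tiling[OF V(1)]
      by (simp add: add.commute[of k l] matpow_add_vec)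
  qed
  moreover have "R \<in> infl (k + l) T" by (rule infl_addI[OF S(1) R(1)])
  ultimately show ?case by blast
qed

text \<open>
  Fix a tile \<open>T\<close>. As \<open>y\<close> varies, the set of the tiles of \<open>\<T> - y\<close> that meet \<open>T\<close> takes only finitely
  many values, so it suffices to find a common tile for one vector \<open>y\<close> per value: whether a
  descendant of \<open>T\<close> belongs to \<open>\<T> - Q\<^sup>k y\<close> is decided by the tiles of \<open>\<T> - y\<close> that meet \<open>T\<close>.
\<close>

lemma algebraic_coincidence:
  assumes oc: "\<And>U W. overlap_pair U W \<Longrightarrow> infl l U \<inter> infl l W \<noteq> {}"
  shows "\<exists>M. \<exists>S\<in>\<T>. \<forall>y\<in>return_vecs. shift (Qpow M y) S \<in> \<T>"
proof -
  obtain T where T: "T \<in> \<T>" using cover by blast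
  then have Tt: "T \<in> tiles" using tiling_subset_tiles by blast
  define near where "near = {W. translated W \<and> supp W \<inter> supp T \<noteq> {}}"
  have fin: "finite near" unfolding near_def
    by (rule translated_locally_finite[OF compact_imp_bounded[OF tile_compact[OF Tt]]])
  \<comment> \<open>The vectors \<open>y\<close> are grouped by the tiles of \<open>\<T> - y\<close> near \<open>T\<close>; the finite set \<open>F\<close> contains one
    vector of each group.\<close>
  define conf where "conf y = {W \<in> near. shift y W \<in> \<T>}" for y
  have "finite (conf ` return_vecs)"
    by (rule finite_subset[of _ "Pow near"]) (use fin in \<open>auto simp: conf_def\<close>)
  then obtain F where F: "F \<subseteq> return_vecs" "finite F" "conf ` return_vecs = conf ` F"
    using finite_subset_image[of "conf ` return_vecs" conf return_vecs] by auto
  obtain k S where S: "S \<in> infl k T" "\<And>y. y \<in> F \<Longrightarrow> shift (Qpow k y) S \<in> \<T>"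
    using common_coincidence_finite[OF oc F(2,1) T] by blast
  have S\<T>: "S \<in> \<T>" by (rule infl_in_tiling[OF T S(1)])
  have "shift (Qpow k y) S \<in> \<T>" if y: "y \<in> return_vecs" for y
  proof -
    obtain x where x: "x \<in> F" "conf x = conf y" using F(3) y by (metis imageE imageI)
    have "shift (Qpow k x) S \<in> (\<Union>V\<in>\<T>. infl k V)" unfolding Union_infl using S(2)[OF x(1)] .
    then obtain V where V: "V \<in> \<T>" "shift (Qpow k x) S \<in> infl k V" by blast
    define W where "W = shift (- x) V"
    have V': "V = shift x W" by (simp add: W_def)
    have SW: "S \<in> infl k W" using V(2) by (simp add: W_def infl_shift_iff Qpow_minus)
    have trans: "translated W" unfolding translated_def using x(1) F(1) V(1) V' by blast
    obtain p where p: "p \<in> supp S" using tile_nonempty infl_in_tiles[OF Tt S(1)] by blast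
    obtain q where q: "q \<in> supp T" "p = Qpow k q" using infl_supp_subset[OF Tt S(1)] p by blast
    obtain q' where q': "q' \<in> supp W" "p = Qpow k q'"
      using infl_supp_subset[OF translated_in_tiles[OF trans] SW] p by blast
    have "q = q'" using q(2) q'(2) inj_Qpow by (simp add: inj_eq)
    then have "W \<in> near" unfolding near_def using trans q(1) q'(1) by blast
    then have "W \<in> conf x" unfolding conf_def using V(1) V' by blast
    then have "W \<in> conf y" by (simp only: x(2))
    then have "shift y W \<in> \<T>" unfolding conf_def by blast
    moreover have "shift (Qpow k y) S \<in> infl k (shift y W)" using SW by (simp add: infl_shift)
    ultimately show ?thesis by (rule infl_in_tiling)
  qed
  then show ?thesis using S\<T> by blast
qed

lemma Qpow_diff_return_vecs:
  assumes "\<And>U W. overlap_pair U W \<Longrightarrow> infl l U \<inter> infl l W \<noteq> {}"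
  shows "\<exists>M. \<forall>x\<in>return_vecs. \<forall>y\<in>return_vecs. Qpow M (x - y) \<in> return_vecs"
proof -
  obtain M S where S: "\<And>y. y \<in> return_vecs \<Longrightarrow> shift (Qpow M y) S \<in> \<T>"
    using algebraic_coincidence[OF assms] by blast
  have "Qpow M (x - y) \<in> return_vecs" if x: "x \<in> return_vecs" and y: "y \<in> return_vecs" for x y
    unfolding return_vecs_iff by (rule bexI[OF _ S[OF y]]) (simp add: Qpow_diff S[OF x])
  then show ?thesis by blast
qed

section \<open>Pairs that never coincide\<close>

definition never_coincident :: "('d, 'c) tile \<Rightarrow> ('d, 'c) tile \<Rightarrow> bool" where
  "never_coincident U W \<longleftrightarrow> overlap_pair U W \<and> (\<forall>k. infl k U \<inter> infl k W = {})"

lemma coincidence_shift: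
  assumes "infl k (shift z U) \<inter> infl k (shift z W) \<noteq> {}"
  shows "infl k U \<inter> infl k W \<noteq> {}"
proof -
  obtain S where "S \<in> infl k (shift z U)" "S \<in> infl k (shift z W)" using assms by blast
  then have "shift (- Qpow k z) S \<in> infl k U \<inter> infl k W" unfolding infl_shift_iff by (rule IntI)
  then show ?thesis by blast
qed

text \<open>
  Coincidences persist at higher levels and depend only on the class of the pair. If every pair led
  to a coincidence, one level for each of the finitely many classes would suffice, and the sum of
  these levels would serve all pairs.
\<close>

lemma never_coincident_exists:
  assumes "\<not> overlap_coincidence A Q D \<T>"
  shows "\<exists>U W. never_coincident U W"
proof (rule ccontr)
  assume "\<nexists>U W. never_coincident U W"
  then have co: "\<exists>k. infl k U \<inter> infl k W \<noteq> {}" if "overlap_pair U W" for U W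
    using that unfolding never_coincident_def by blast
  define C where "C = {pair_class (U, W) | U W. overlap_pair U W}"
  have "\<forall>p\<in>C. \<exists>k. \<forall>U W. overlap_pair U W \<and> pair_class (U, W) = p \<longrightarrow> infl k U \<inter> infl k W \<noteq> {}"
  proof
    fix p assume "p \<in> C"
    then obtain U W where UW: "overlap_pair U W" "p = pair_class (U, W)" unfolding C_def by blast
    obtain k where k: "infl k U \<inter> infl k W \<noteq> {}" using co[OF UW(1)] by (rule exE)
    have "infl k U' \<inter> infl k W' \<noteq> {}" if U': "overlap_pair U' W'" "pair_class (U', W') = p" for U' W'
    proof -
      obtain z where "U = shift z U'" "W = shift z W'"
        using pair_class_eqD[of U' W' U W] U' UW overlap_pair_tiles by auto
      then show ?thesis using k coincidence_shift by simp
    qed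
    then show "\<exists>k. \<forall>U W. overlap_pair U W \<and> pair_class (U, W) = p \<longrightarrow> infl k U \<inter> infl k W \<noteq> {}"
      by blast
  qed
  from bchoice[OF this] obtain K where K: "\<forall>p\<in>C. \<forall>U W. overlap_pair U W \<and> pair_class (U, W) = p \<longrightarrow>
      infl (K p) U \<inter> infl (K p) W \<noteq> {}"
    by (rule exE)
  have fin: "finite C" unfolding C_def by (rule finite_pair_classes)
  define l where "l = Suc (\<Sum>p\<in>C. K p)"
  have "infl l U \<inter> infl l W \<noteq> {}" if UW: "overlap_pair U W" for U W
  proof -
    have C: "pair_class (U, W) \<in> C" unfolding C_def using UW by blast
    then have co: "infl (K (pair_class (U, W))) U \<inter> infl (K (pair_class (U, W))) W \<noteq> {}"
      using K UW by blast
    have "K (pair_class (U, W)) \<le> (\<Sum>p\<in>C. K p)" by (rule member_le_sum[OF C _ fin]) simp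
    then show ?thesis
      by (intro coincidence_mono[OF co overlap_pair_tiles(1)[OF UW]]) (simp add: l_def)
  qed
  moreover have "l > 0" by (simp add: l_def)
  ultimately show False using assms unfolding overlap_coincidence_iff by blast
qed

lemma never_coincident_infl:
  assumes "never_coincident U W" "U' \<in> infl k U" "W' \<in> infl k W" "interior (supp U') \<inter> interior (supp W') \<noteq> {}"
  shows "never_coincident U' W'"
proof -
  have "infl l U' \<inter> infl l W' = {}" for l
  proof -
    have "infl l U' \<subseteq> infl (k + l) U" "infl l W' \<subseteq> infl (k + l) W"
      using assms(2,3) infl_addI by blast+
    then show ?thesis using assms(1) unfolding never_coincident_def by blast
  qed
  then show ?thesis using overlap_pair_infl assms unfolding never_coincident_def by blast
qed

text \<open>
  Descendants in the interior of the inflated tile. A tile map with such values has its control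
  points in the interiors of the tiles.
\<close>

definition deep :: "nat \<Rightarrow> ('d, 'c) tile \<Rightarrow> ('d, 'c) tile \<Rightarrow> bool" where
  "deep k T S \<longleftrightarrow> S \<in> infl k T \<and> supp S \<subseteq> (*v) (matpow Q k) ` interior (supp T)"

lemma deep_infl:
  assumes "deep k T S" "R \<in> infl l S" "T \<in> tiles"
  shows "deep (k + l) T R"
proof -
  have "S \<in> tiles" using assms infl_in_tiles unfolding deep_def by blast
  then have "supp R \<subseteq> Qpow l ` supp S" using infl_supp_subset assms(2) by blast
  also have "\<dots> \<subseteq> Qpow l ` Qpow k ` interior (supp T)"
    using assms(1) unfolding deep_def by (intro image_mono) blast
  also have "\<dots> = Qpow (k + l) ` interior (supp T)"
    unfolding image_image add.commute[of k l] matpow_add_vec ..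
  finally show ?thesis using assms infl_addI unfolding deep_def by blast
qed

lemma deep_shift:
  assumes "deep k T S"
  shows "deep k (shift x T) (shift (Qpow k x) S)"
proof -
  have "supp (shift (Qpow k x) S) \<subseteq> (+) (Qpow k x) ` Qpow k ` interior (supp T)"
    unfolding supp_shift using assms unfolding deep_def by (intro image_mono) blast
  also have "\<dots> = Qpow k ` interior (supp (shift x T))"
    unfolding interior_supp_shift image_image Qpow_add ..
  finally show ?thesis using assms unfolding deep_def by (simp add: infl_shift)
qed

text \<open>
  At a high level, tiles near the image of a common interior point \<open>p\<close> of \<open>U\<close> and \<open>W\<close> stay within
  the image of a small ball around \<open>p\<close>. The radius is doubled twice: \<open>U'\<close> contains the image of
  \<open>p\<close>, but \<open>W'\<close> is only known to meet \<open>U'\<close>.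
\<close>

lemma deep_pair:
  assumes "U \<in> tiles" "W \<in> tiles" "interior (supp U) \<inter> interior (supp W) \<noteq> {}"
  shows "\<exists>k0. \<forall>k\<ge>k0. \<exists>U'\<in>infl k U. \<exists>W'\<in>infl k W.
    interior (supp U') \<inter> interior (supp W') \<noteq> {} \<and>
    supp U' \<subseteq> (*v) (matpow Q k) ` (interior (supp U) \<inter> interior (supp W)) \<and>
    supp W' \<subseteq> (*v) (matpow Q k) ` (interior (supp U) \<inter> interior (supp W))"
proof -
  let ?I = "interior (supp U) \<inter> interior (supp W)"
  obtain p where p: "p \<in> ?I" using assms(3) by blast
  have "open ?I" by (intro open_Int open_interior)
  then obtain e where e: "e > 0" "ball p e \<subseteq> ?I" using p open_contains_ball by blast
  define \<epsilon> where "\<epsilon> = e / 4"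
  have \<epsilon>: "\<epsilon> > 0" "2 * \<epsilon> > 0" "ball p (2 * (2 * \<epsilon>)) \<subseteq> ?I" using e by (simp_all add: \<epsilon>_def)
  then have b2: "ball p (2 * \<epsilon>) \<subseteq> ?I" using subset_ball[of "2 * \<epsilon>" "2 * (2 * \<epsilon>)" p] by auto
  obtain k1 where k1: "\<forall>k\<ge>k1. \<forall>T\<in>tiles. supp T \<inter> Qpow k ` ball p \<epsilon> \<noteq> {} \<longrightarrow>
      supp T \<subseteq> Qpow k ` ball p (2 * \<epsilon>)"
    using tiles_near_inflated_point[OF \<epsilon>(1)] by (rule exE)
  obtain k2 where k2: "\<forall>k\<ge>k2. \<forall>T\<in>tiles. supp T \<inter> Qpow k ` ball p (2 * \<epsilon>) \<noteq> {} \<longrightarrow>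
      supp T \<subseteq> Qpow k ` ball p (2 * (2 * \<epsilon>))"
    using tiles_near_inflated_point[OF \<epsilon>(2)] by (rule exE)
  show ?thesis
  proof (intro exI[of _ "max k1 k2"] allI impI)
    fix k assume k: "max k1 k2 \<le> k"
    have "Qpow k p \<in> Qpow k ` supp U" using p interior_subset by blast
    then have "Qpow k p \<in> (\<Union>S\<in>infl k U. supp S)" unfolding supp_infl[OF assms(1)] .
    then obtain U' where U': "U' \<in> infl k U" "Qpow k p \<in> supp U'" by blast
    have U't: "U' \<in> tiles" by (rule infl_in_tiles[OF assms(1) U'(1)])
    have "p \<in> ball p \<epsilon>" using \<epsilon>(1) by simp
    then have ne: "supp U' \<inter> Qpow k ` ball p \<epsilon> \<noteq> {}" using U'(2) by blast
    have sU': "supp U' \<subseteq> Qpow k ` ball p (2 * \<epsilon>)"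
      by (rule k1[rule_format, OF _ U't ne]) (use k in simp)
    then have iU': "interior (supp U') \<subseteq> Qpow k ` ball p (2 * \<epsilon>)" using interior_subset by blast
    have "interior (supp U') \<subseteq> Qpow k ` supp W" using iU' b2 interior_subset by blast
    then obtain W' where W': "W' \<in> infl k W" "interior (supp U') \<inter> interior (supp W') \<noteq> {}"
      using open_meets_infl[OF assms(2) open_interior tile_interior_nonempty[OF U't]] by blast
    have W't: "W' \<in> tiles" by (rule infl_in_tiles[OF assms(2) W'(1)])
    have ne: "supp W' \<inter> Qpow k ` ball p (2 * \<epsilon>) \<noteq> {}" using W'(2) iU' interior_subset by blast
    have "supp W' \<subseteq> Qpow k ` ball p (2 * (2 * \<epsilon>))"
      by (rule k2[rule_format, OF _ W't ne]) (use k in simp)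
    then have "supp W' \<subseteq> Qpow k ` ?I" using \<epsilon>(3) by blast
    moreover have "supp U' \<subseteq> Qpow k ` ?I" using sU' b2 by blast
    ultimately show "\<exists>U'\<in>infl k U. \<exists>W'\<in>infl k W. interior (supp U') \<inter> interior (supp W') \<noteq> {} \<and>
        supp U' \<subseteq> Qpow k ` ?I \<and> supp W' \<subseteq> Qpow k ` ?I"
      using U'(1) W' by blast
  qed
qed

text \<open>
  A deep descendant stays deep under further inflation, and by primitivity all colors appear then.
\<close>

lemma deep_tile_of_color:
  "\<exists>k0. \<forall>k\<ge>k0. \<forall>e i. \<exists>S. deep k (prototile A e) S \<and> color S = i"
proof -
  obtain K where K: "\<forall>k\<ge>K. \<forall>T\<in>tiles. \<forall>i. \<exists>S\<in>infl k T. color S = i"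
    using all_colors_in_infl by (rule exE)
  have "\<exists>k1 S. deep k1 (prototile A e) S" for e
  proof -
    have "interior (supp (prototile A e)) \<inter> interior (supp (prototile A e)) \<noteq> {}"
      using tile_interior_nonempty[OF prototile_tiles] by simp
    from deep_pair[OF prototile_tiles prototile_tiles this]
    obtain k S where "S \<in> infl k (prototile A e)"
      "supp S \<subseteq> Qpow k ` (interior (supp (prototile A e)) \<inter> interior (supp (prototile A e)))"
      by blast
    then have "deep k (prototile A e) S" unfolding deep_def by blast
    then show ?thesis by blast
  qed
  then have "\<forall>e. \<exists>k1. \<exists>S. deep k1 (prototile A e) S" by blast
  from choice[OF this] obtain k1 where "\<forall>e. \<exists>S. deep (k1 e) (prototile A e) S" by (rule exE)
  from choice[OF this] obtain S1 where "\<forall>e. deep (k1 e) (prototile A e) (S1 e)" by (rule exE)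
  then have S1: "\<And>e. deep (k1 e) (prototile A e) (S1 e)" by (rule spec)
  show ?thesis
  proof (intro exI[of _ "(\<Sum>e\<in>UNIV. k1 e) + K"] allI impI)
    fix k e i assume k: "(\<Sum>e\<in>UNIV. k1 e) + K \<le> k"
    have "k1 e \<le> (\<Sum>e\<in>UNIV. k1 e)" by (rule member_le_sum) simp_all
    then have k': "k1 e + (k - k1 e) = k" "K \<le> k - k1 e" using k by simp_all
    have "S1 e \<in> tiles" using S1[of e] infl_in_tiles[OF prototile_tiles] unfolding deep_def by blast
    then obtain R where R: "R \<in> infl (k - k1 e) (S1 e)" "color R = i" using K k'(2) by blast
    have "deep (k1 e + (k - k1 e)) (prototile A e) R"
      by (rule deep_infl[OF S1 R(1) prototile_tiles])
    then show "\<exists>S. deep k (prototile A e) S \<and> color S = i" unfolding k'(1) using R(2) by blast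
  qed
qed

section \<open>Tilings with a bounded one-color cluster\<close>

text \<open>
  A patch occurs in some inflation of some tile \<open>T\<close>, as \<open>\<T>\<close> is a substitution tiling, and by
  primitivity a translate of \<open>T\<close> occurs among the descendants of a tile that lies well inside the
  intersection of the inflated tiles.
\<close>

lemma patch_occurs_deep:
  assumes "finite N" "N \<subseteq> \<T>" "U \<in> tiles" "W \<in> tiles"
    and "interior (supp U) \<inter> interior (supp W) \<noteq> {}"
  shows "\<exists>n g. \<forall>S\<in>N. shift g S \<in> infl n U \<and>
    supp (shift g S) \<subseteq> (*v) (matpow Q n) ` (interior (supp U) \<inter> interior (supp W))"
proof -
  let ?I = "interior (supp U) \<inter> interior (supp W)"
  have "patch_of \<T> N" unfolding patch_of_def using assms by blast
  then obtain k T g0 where T: "T \<in> \<T>" "shift g0 ` N \<subseteq> infl k T"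
    using substitution_tiling unfolding substitution_tiling_def infl_def by blast
  have Tt: "T \<in> tiles" using T(1) tiling_subset_tiles by blast
  obtain m U' where U': "U' \<in> infl m U" "supp U' \<subseteq> Qpow m ` ?I"
    using deep_pair[OF assms(3-5)] by blast
  have U't: "U' \<in> tiles" by (rule infl_in_tiles[OF assms(3) U'(1)])
  obtain K where "\<forall>k\<ge>K. \<forall>T\<in>tiles. \<forall>i. \<exists>S\<in>infl k T. color S = i"
    using all_colors_in_infl by (rule exE)
  then obtain S where S: "S \<in> infl K U'" "color S = color T" using U't by blast
  have St: "S \<in> tiles" by (rule infl_in_tiles[OF U't S(1)])
  define z where "z = position S - position T"
  have Sz: "S = shift z T"
    by (rule tile_eqI) (simp_all add: St Tt S(2) position_shift z_def)
  define g where "g = Qpow k z + g0"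
  have "shift g R \<in> infl (m + K + k) U \<and> supp (shift g R) \<subseteq> Qpow (m + K + k) ` ?I"
    if R: "R \<in> N" for R
  proof -
    have "shift g0 R \<in> infl k T" using T(2) R by blast
    then have "shift (Qpow k z) (shift g0 R) \<in> infl k S" unfolding Sz infl_shift by (rule imageI)
    then have gR: "shift g R \<in> infl k S" unfolding g_def shift_shift .
    have "supp (shift g R) \<subseteq> Qpow k ` supp S" by (rule infl_supp_subset[OF St gR])
    also have "\<dots> \<subseteq> Qpow k ` Qpow K ` supp U'"
      by (intro image_mono infl_supp_subset[OF U't S(1)])
    also have "\<dots> \<subseteq> Qpow k ` Qpow K ` Qpow m ` ?I" by (intro image_mono U'(2))
    also have "\<dots> = Qpow (k + (K + m)) ` ?I" unfolding image_image matpow_add_vec ..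
    also have "k + (K + m) = m + K + k" by simp
    finally show ?thesis using infl_addI[OF infl_addI[OF U'(1) S(1)] gR] by blast
  qed
  then show ?thesis by blast
qed

lemma supp_eq_position: "T \<in> tiles \<Longrightarrow> supp T = (+) (position T) ` A (color T)"
proof -
  assume "T \<in> tiles"
  then obtain x i where "T = shift x (prototile A i)" unfolding tiles_def by blast
  moreover have "supp (prototile A i) = A i" by (simp add: prototile_def)
  ultimately show ?thesis by simp
qed

lemma common_tile_of_equal_supports:
  assumes "finite C" "C \<noteq> {}" "finite C'" "C' \<noteq> {}" "C \<subseteq> tiles" "C' \<subseteq> tiles"
    and col: "\<And>S. S \<in> C \<union> C' \<Longrightarrow> color S = i"
    and eq: "patch_supp C = patch_supp C'"
  shows "C \<inter> C' \<noteq> {}"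
proof -
  have un: "(\<Union>f\<in>position ` X. (+) f ` A i) = patch_supp X" if X: "X \<subseteq> C \<union> C'" for X
  proof -
    have "(+) (position S) ` A i = supp S" if "S \<in> X" for S
    proof -
      have "S \<in> C \<union> C'" "S \<in> tiles" using that X assms(5,6) by blast+
      then show ?thesis using supp_eq_position[of S] col[of S] by simp
    qed
    then show ?thesis unfolding patch_supp_def image_image by simp
  qed
  have "position ` C \<inter> position ` C' \<noteq> {}"
    using assms(1-4)
    by (intro common_translate_of_equal_unions[OF prototile_compact[of i] prototile_supp_nonempty])
      (simp_all only: un Un_upper1 Un_upper2 eq finite_imageI image_is_empty not_False_eq_True)
  then obtain S S' where S: "S \<in> C" "S' \<in> C'" "position S = position S'" by blast
  then have "S = S'" using assms(5,6) col[of S] col[of S'] by (intro tile_eqI) auto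
  then show ?thesis using S by blast
qed

text \<open>
  Start from a tile that belongs to no rod and pass repeatedly to touching tiles of the same color.
  Since tiles are connected, so is the cluster of all tiles that are reached; it would be a rod if
  it were unbounded.
\<close>

lemma bounded_monochromatic_cluster:
  assumes conn: "\<forall>T\<in>\<T>. connected (supp T)" and nonrod: "\<not> rod_tiling \<T>"
  shows "\<exists>C i. C \<noteq> {} \<and> C \<subseteq> \<T> \<and> (\<forall>S\<in>C. color S = i) \<and> bounded (patch_supp C) \<and>
    (\<forall>S\<in>C. \<forall>R\<in>\<T>. color R = i \<longrightarrow> supp S \<inter> supp R \<noteq> {} \<longrightarrow> R \<in> C)"
proof -
  obtain T where T: "T \<in> \<T>" "\<And>R. rod \<T> R \<Longrightarrow> T \<notin> R"
    using nonrod unfolding rod_tiling_def by blast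
  define touch where "touch S R \<longleftrightarrow> R \<in> \<T> \<and> color R = color T \<and> supp S \<inter> supp R \<noteq> {}"
    for S R :: "('d, 'c) tile"
  define C where "C = {S. touch\<^sup>*\<^sup>* T S}"
  have C: "S \<in> \<T> \<and> color S = color T" if "S \<in> C" for S
  proof -
    have "touch\<^sup>*\<^sup>* T S" using that unfolding C_def by simp
    then show ?thesis
      by (induction rule: rtranclp_induct) (use T(1) in \<open>simp_all add: touch_def\<close>)
  qed
  have TC: "T \<in> C" unfolding C_def by simp
  have closed: "R \<in> C" if "S \<in> C" "R \<in> \<T>" "color R = color T" "supp S \<inter> supp R \<noteq> {}" for S R
  proof -
    have "touch S R" unfolding touch_def using that by blast
    then show ?thesis using that(1) unfolding C_def by (simp add: rtranclp.rtrancl_into_rtrancl)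
  qed
  let ?X = "patch_supp C"
  have sub: "supp S \<subseteq> ?X" if "S \<in> C" for S using that unfolding patch_supp_def by blast
  obtain t0 where t0: "t0 \<in> supp T" using tile_nonempty T(1) tiling_subset_tiles by blast
  have comp: "supp S \<subseteq> connected_component_set ?X t0" if "touch\<^sup>*\<^sup>* T S" for S
    using that
  proof (induction rule: rtranclp_induct)
    case base
    show ?case by (rule connected_component_maximal[OF t0 conn[rule_format, OF T(1)] sub[OF TC]])
  next
    case (step S R)
    then have R: "R \<in> C" unfolding C_def by (simp add: rtranclp.rtrancl_into_rtrancl)
    obtain q where q: "q \<in> supp S" "q \<in> supp R" using step.hyps(2) unfolding touch_def by blast
    have "supp R \<subseteq> connected_component_set ?X q"
      using C[OF R] by (intro connected_component_maximal[OF q(2) conn[rule_format] sub[OF R]]) blast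
    moreover have "q \<in> connected_component_set ?X t0" using q(1) step.IH by (rule subsetD[rotated])
    then have "connected_component_set ?X q = connected_component_set ?X t0"
      by (rule connected_component_eq)
    ultimately show ?case by (simp only:)
  qed
  have "?X \<subseteq> connected_component_set ?X t0"
    unfolding patch_supp_def using comp unfolding C_def patch_supp_def by blast
  then have "connected_component_set ?X t0 = ?X" using connected_component_subset by blast
  then have conX: "connected ?X" using connected_connected_component[of ?X t0] by simp
  have bdd: "bounded ?X"
  proof (rule ccontr)
    assume "\<not> bounded ?X"
    moreover have "C \<subseteq> \<T>" "\<forall>S\<in>C. \<forall>R\<in>C. color S = color R" using C by auto
    ultimately have "rod \<T> C" unfolding rod_def using conX by blast
    then show False using T(2) TC by blast
  qed
  show ?thesis
  proof (intro exI[of _ C] exI[of _ "color T"] conjI ballI impI)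
    show "C \<noteq> {}" "C \<subseteq> \<T>" using TC C by blast+
    show "color S = color T" if "S \<in> C" for S using C[OF that] by blast
    show "bounded ?X" by (rule bdd)
    show "R \<in> C" if "S \<in> C" "R \<in> \<T>" "color R = color T" "supp S \<inter> supp R \<noteq> {}" for S R
      using closed[OF that] .
  qed
qed

lemma translated_connected:
  assumes conn: "\<forall>T\<in>\<T>. connected (supp T)" and "translated W"
  shows "connected (supp W)"
proof -
  obtain y where y: "shift y W \<in> \<T>" using assms(2) unfolding translated_def by blast
  have "connected ((+) (- y) ` supp (shift y W))"
    using conn y by (intro connected_continuous_image continuous_intros) blast
  then show ?thesis unfolding supp_shift by (simp add: image_image)
qed

lemma supp_subset_if_interior_subset:
  assumes "T \<in> tiles" "finite P" "P \<subseteq> tiles" "interior (supp T) \<subseteq> patch_supp P"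
  shows "supp T \<subseteq> patch_supp P"
proof -
  have "closed (patch_supp P)"
    unfolding patch_supp_def using assms(2,3) tile_closed by (intro closed_UN) auto
  then have "closure (interior (supp T)) \<subseteq> patch_supp P" using assms(4) closure_minimal by blast
  then show ?thesis unfolding tile_closure_interior[OF assms(1)] .
qed

text \<open>
  Suppose that all overlapping descendants have equal colors. Copy the cluster \<open>C\<close>, together with
  its surroundings \<open>N\<close>, into the intersection of the inflated tiles, and let \<open>V\<close> be the set of the
  descendants of \<open>W\<close> that overlap the copy \<open>C'\<close>. A tile \<open>R\<close> of \<open>V\<close> is covered by descendants of
  \<open>U\<close>, all of the color of the cluster. As \<open>R\<close> is connected, these tiles are linked to \<open>C'\<close> by a
  chain of touching tiles, so they belong to \<open>C'\<close> by maximality of the cluster. Hence \<open>C'\<close> and \<open>V\<close>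
  have the same union. They consist of translates of one prototile, so they share a tile: a
  coincidence.
\<close>

lemma never_coincident_reaches_two_colors:
  assumes conn: "\<forall>T\<in>\<T>. connected (supp T)" and nonrod: "\<not> rod_tiling \<T>"
    and bad: "never_coincident U W"
  shows "\<exists>k. \<exists>U'\<in>infl k U. \<exists>W'\<in>infl k W.
    interior (supp U') \<inter> interior (supp W') \<noteq> {} \<and> color U' \<noteq> color W'"
proof (rule ccontr)
  assume contra: "\<not> ?thesis"
  have mono: "color U' = color W'" if "U' \<in> infl k U" "W' \<in> infl k W"
    "interior (supp U') \<inter> interior (supp W') \<noteq> {}" for k U' W'
    using contra that by blast
  have pair: "overlap_pair U W" using bad unfolding never_coincident_def by blast
  have t: "U \<in> tiles" "W \<in> tiles" using overlap_pair_tiles[OF pair] .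
  have transW: "translated W" using pair unfolding overlap_pair_def by blast
  from bounded_monochromatic_cluster[OF conn nonrod]
  obtain C i where C: "C \<noteq> {}" "C \<subseteq> \<T>" "\<forall>S\<in>C. color S = i" "bounded (patch_supp C)"
    and Cclosed: "\<forall>S\<in>C. \<forall>R\<in>\<T>. color R = i \<longrightarrow> supp S \<inter> supp R \<noteq> {} \<longrightarrow> R \<in> C"
    by (elim exE conjE)
  obtain \<delta> where \<delta>: "\<delta> > 0" "\<And>T x y. T \<in> tiles \<Longrightarrow> x \<in> supp T \<Longrightarrow> y \<in> supp T \<Longrightarrow> dist x y \<le> \<delta>"
    using tile_diameter by blast
  obtain r where r: "\<And>x. x \<in> patch_supp C \<Longrightarrow> norm x \<le> r"
    using C(4) unfolding bounded_iff by blast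
  \<comment> \<open>The surroundings reach so far that every tile overlapping the cluster is covered by tiles of
    \<open>N\<close>.\<close>
  define B where "B = cball (0 :: real ^ 'd) (r + \<delta>)"
  define N where "N = {S \<in> \<T>. supp S \<inter> B \<noteq> {}}"
  have finN: "finite N"
  proof (rule finite_subset)
    show "N \<subseteq> {S. translated S \<and> supp S \<inter> B \<noteq> {}}" unfolding N_def using tiling_translated by blast
    show "finite {S. translated S \<and> supp S \<inter> B \<noteq> {}}"
      unfolding B_def by (rule translated_locally_finite[OF bounded_cball])
  qed
  have N\<T>: "N \<subseteq> \<T>" unfolding N_def by blast
  have CN: "C \<subseteq> N"
  proof
    fix S assume S: "S \<in> C"
    then obtain q where q: "q \<in> supp S" using tile_nonempty C(2) tiling_subset_tiles by blast
    then have "q \<in> patch_supp C" unfolding patch_supp_def using S by blast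
    then have "q \<in> B" unfolding B_def using r[of q] \<delta>(1) by simp
    then show "S \<in> N" unfolding N_def using S C(2) q by blast
  qed
  have "interior (supp U) \<inter> interior (supp W) \<noteq> {}" using pair unfolding overlap_pair_def by blast
  from patch_occurs_deep[OF finN N\<T> t this]
  obtain n g where g: "\<And>S. S \<in> N \<Longrightarrow> shift g S \<in> infl n U"
    "\<And>S. S \<in> N \<Longrightarrow>
      supp (shift g S) \<subseteq> (*v) (matpow Q n) ` (interior (supp U) \<inter> interior (supp W))" by blast
  define C' where "C' = shift g ` C"
  define V where "V = {R \<in> infl n W. \<exists>S\<in>C'. interior (supp S) \<inter> interior (supp R) \<noteq> {}}"
  have C'U: "C' \<subseteq> infl n U" unfolding C'_def using g(1) CN by blast
  have C't: "C' \<subseteq> tiles" using C'U infl_in_tiles[OF t(1)] by blast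
  have C'c: "color S = i" if "S \<in> C'" for S using that C(3) unfolding C'_def by auto
  have finC': "finite C'" unfolding C'_def using finite_subset[OF CN finN] by (rule finite_imageI)
  have VW: "V \<subseteq> infl n W" unfolding V_def by blast
  have Vt: "V \<subseteq> tiles" using VW infl_in_tiles[OF t(2)] by blast
  have Vc: "color R = i" if R: "R \<in> V" for R
  proof -
    obtain S where S: "S \<in> C'" "interior (supp S) \<inter> interior (supp R) \<noteq> {}" "R \<in> infl n W"
      using R unfolding V_def by blast
    have "color S = color R" by (rule mono[OF subsetD[OF C'U S(1)] S(3,2)])
    then show ?thesis using C'c[OF S(1)] by simp
  qed
  have finV: "finite V" by (rule finite_subset[OF VW finite_infl[OF t(2)]])
  have C'sub: "patch_supp C' \<subseteq> patch_supp V"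
  proof -
    have "supp S \<subseteq> patch_supp V" if S: "S \<in> C'" for S
    proof (rule supp_subset_if_interior_subset[OF subsetD[OF C't S] finV Vt], rule subsetI)
      fix p assume p: "p \<in> interior (supp S)"
      obtain S0 where S0: "S0 \<in> N" "S = shift g S0" using S CN unfolding C'_def by blast
      have "p \<in> supp (shift g S0)" using p interior_subset unfolding S0(2) by blast
      then have "p \<in> Qpow n ` supp W" using g(2)[OF S0(1)] interior_subset by blast
      then have "p \<in> (\<Union>R\<in>infl n W. supp R)" unfolding supp_infl[OF t(2)] .
      then obtain R where R: "R \<in> infl n W" "p \<in> supp R" by blast
      have "interior (supp S) \<inter> interior (supp R) \<noteq> {}"
        by (rule open_meets_interior[OF infl_in_tiles[OF t(2) R(1)] open_interior p R(2)])
      then have "R \<in> V" unfolding V_def using R(1) S by blast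
      then show "p \<in> patch_supp V" unfolding patch_supp_def using R(2) by blast
    qed
    then show ?thesis unfolding patch_supp_def by blast
  qed
  have Vsub: "patch_supp V \<subseteq> patch_supp C'"
  proof -
    have "supp R \<subseteq> patch_supp C'" if R: "R \<in> V" for R
    proof -
      have Rt: "R \<in> tiles" using Vt R by blast
      have RW: "R \<in> infl n W" using VW R by blast
      obtain S1 where S1: "S1 \<in> C'" "interior (supp S1) \<inter> interior (supp R) \<noteq> {}"
        using R unfolding V_def by blast
      define P where "P = {S \<in> shift g ` N. interior (supp S) \<inter> interior (supp R) \<noteq> {}}"
      have finP: "finite P" unfolding P_def using finN by simp
      have PU: "P \<subseteq> infl n U" unfolding P_def using g(1) by blast
      have Pt: "P \<subseteq> tiles" using PU infl_in_tiles[OF t(1)] by blast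
      have S1P: "S1 \<in> P" unfolding P_def using S1 CN unfolding C'_def by blast
      have Pc: "color S = i" if "S \<in> P" for S
      proof -
        have "color S = color R"
          using that PU by (intro mono[OF _ RW]) (auto simp: P_def)
        then show ?thesis using Vc[OF R] by simp
      qed
      have cover_R: "supp R \<subseteq> patch_supp P"
      proof (rule supp_subset_if_interior_subset[OF Rt finP Pt], rule subsetI)
        fix p assume p: "p \<in> interior (supp R)"
        obtain q where q: "q \<in> supp S1" "q \<in> supp R" using S1(2) interior_subset by blast
        obtain S0 where S0: "S0 \<in> C" "S1 = shift g S0" using S1(1) unfolding C'_def by blast
        obtain q0 where q0: "q = g + q0" "q0 \<in> supp S0" using q(1) unfolding S0(2) supp_shift by blast
        have "q0 \<in> patch_supp C" unfolding patch_supp_def using q0(2) S0(1) by blast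
        then have "norm q0 \<le> r" by (rule r)
        moreover have "dist p q \<le> \<delta>"
          using p interior_subset q(2) by (intro \<delta>(2)[OF Rt]) blast+
        then have "norm ((p - g) - q0) \<le> \<delta>" unfolding q0(1) dist_norm by (simp add: algebra_simps)
        moreover have "norm (p - g) \<le> norm ((p - g) - q0) + norm q0"
          using norm_triangle_ineq[of "(p - g) - q0" q0] by simp
        ultimately have pB: "p - g \<in> B" unfolding B_def by simp
        obtain S where S: "S \<in> \<T>" "p - g \<in> supp S" using cover by blast
        have SN: "S \<in> N" unfolding N_def using S pB by blast
        have pS: "p \<in> supp (shift g S)" unfolding supp_shift by (rule image_eqI[OF _ S(2)]) simp
        have "shift g S \<in> tiles" using S(1) tiling_subset_tiles by auto
        then have "interior (supp R) \<inter> interior (supp (shift g S)) \<noteq> {}"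
          by (rule open_meets_interior[OF _ open_interior p pS])
        then have "shift g S \<in> P" unfolding P_def using SN by blast
        then show "p \<in> patch_supp P" unfolding patch_supp_def using pS by blast
      qed
      have "P \<subseteq> C'"
      proof (rule ccontr)
        assume "\<not> P \<subseteq> C'"
        then obtain S2 where S2: "S2 \<in> P" "S2 \<notin> C'" by blast
        \<comment> \<open>The tiles of \<open>P\<close> inside and outside of \<open>C'\<close> form two closed sets that cover the connected set
          \<open>supp R\<close>, so some of them touch, and maximality of the cluster applies.\<close>
        define F1 where "F1 = patch_supp (P \<inter> C')"
        define F2 where "F2 = patch_supp (P - C')"
        have cl: "closed F1" "closed F2"
          unfolding F1_def F2_def patch_supp_def using finP Pt tile_closed by (intro closed_UN; blast)+
        have "connected (supp R)"
          by (rule translated_connected[OF conn translated_infl[OF transW RW]])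
        moreover have "supp R \<subseteq> F1 \<union> F2"
          using cover_R unfolding F1_def F2_def patch_supp_def by blast
        moreover have "F1 \<inter> supp R \<noteq> {}"
        proof -
          obtain q where "q \<in> supp S1" "q \<in> supp R" using S1(2) interior_subset by blast
          then show ?thesis unfolding F1_def patch_supp_def using S1(1) S1P by blast
        qed
        moreover have "F2 \<inter> supp R \<noteq> {}"
        proof -
          have "interior (supp S2) \<inter> interior (supp R) \<noteq> {}" using S2(1) unfolding P_def by blast
          then obtain q where "q \<in> supp S2" "q \<in> supp R" using interior_subset by blast
          then show ?thesis unfolding F2_def patch_supp_def using S2 by blast
        qed
        ultimately have "F1 \<inter> F2 \<inter> supp R \<noteq> {}" using cl unfolding connected_closed by blast
        then obtain S3 S4 q where S34: "S3 \<in> P" "S3 \<in> C'" "S4 \<in> P" "S4 \<notin> C'" "q \<in> supp S3" "q \<in> supp S4"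
          unfolding F1_def F2_def patch_supp_def by blast
        obtain a where a: "a \<in> C" "S3 = shift g a" using S34(2) unfolding C'_def by blast
        obtain b where b: "b \<in> N" "S4 = shift g b" using S34(3) unfolding P_def by blast
        have "color b = i" using Pc[OF S34(3)] unfolding b(2) by simp
        moreover have "supp a \<inter> supp b \<noteq> {}"
          using S34(5,6) unfolding a(2) b(2) supp_shift by auto
        ultimately have "b \<in> C" using Cclosed a(1) b(1) N\<T> by blast
        then show False using S34(4) unfolding b(2) C'_def by blast
      qed
      then have "patch_supp P \<subseteq> patch_supp C'" unfolding patch_supp_def by blast
      then show ?thesis using cover_R by blast
    qed
    then show ?thesis unfolding patch_supp_def by blast
  qed
  have eq: "patch_supp C' = patch_supp V" using C'sub Vsub by (rule subset_antisym)
  have C'ne: "C' \<noteq> {}" unfolding C'_def using C(1) by simp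
  then have "patch_supp C' \<noteq> {}" unfolding patch_supp_def using tile_nonempty C't by blast
  then have "patch_supp V \<noteq> {}" by (simp only: eq not_False_eq_True)
  then have Vne: "V \<noteq> {}" unfolding patch_supp_def by blast
  have "C' \<inter> V \<noteq> {}"
    by (rule common_tile_of_equal_supports[OF finC' C'ne finV Vne C't Vt _ eq, of i])
      (use C'c Vc in blast)
  then have "infl n U \<inter> infl n W \<noteq> {}" using C'U VW by blast
  then show False using bad unfolding never_coincident_def by blast
qed

definition deep_step :: "nat \<Rightarrow> ('d, 'c) tile \<times> ('d, 'c) tile \<Rightarrow> ('d, 'c) tile \<times> ('d, 'c) tile \<Rightarrow> bool"
  where "deep_step k p q \<longleftrightarrow> deep k (fst p) (fst q) \<and> deep k (snd p) (snd q)"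

text \<open>
  Every pair that never coincides has a deep descendant, and this in turn has a descendant of two
  colors. Iteration gives an infinite sequence of pairs of two colors, each deep in its predecessor.
  Some class occurs infinitely often, hence twice at a distance larger than any given \<open>n0\<close>.
\<close>

lemma recurrent_never_coincident_pair:
  assumes conn: "\<forall>T\<in>\<T>. connected (supp T)" and nonrod: "\<not> rod_tiling \<T>"
    and no_oc: "\<not> overlap_coincidence A Q D \<T>"
  shows "\<exists>n>n0. \<exists>U W z. never_coincident U W \<and> color U \<noteq> color W \<and> deep n U (shift z U) \<and> deep n W (shift z W)"
proof -
  define H where "H = {p. never_coincident (fst p) (snd p) \<and> color (fst p) \<noteq> color (snd p)}"
  have Ht: "fst p \<in> tiles" "snd p \<in> tiles" if "p \<in> H" for p
    using that overlap_pair_tiles unfolding H_def never_coincident_def by blast+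
  have step: "\<exists>q\<in>H. \<exists>k>0. deep_step k (U, W) q" if bad: "never_coincident U W" for U W
  proof -
    have pair: "overlap_pair U W" using bad unfolding never_coincident_def by blast
    have t: "U \<in> tiles" "W \<in> tiles" using overlap_pair_tiles[OF pair] .
    have "interior (supp U) \<inter> interior (supp W) \<noteq> {}" using pair unfolding overlap_pair_def by blast
    from deep_pair[OF t this] obtain k0 where k0: "\<forall>k\<ge>k0. \<exists>U'\<in>infl k U. \<exists>W'\<in>infl k W.
      interior (supp U') \<inter> interior (supp W') \<noteq> {} \<and>
      supp U' \<subseteq> (*v) (matpow Q k) ` (interior (supp U) \<inter> interior (supp W)) \<and>
      supp W' \<subseteq> (*v) (matpow Q k) ` (interior (supp U) \<inter> interior (supp W))" by (rule exE)
    obtain U' W' where U': "U' \<in> infl (Suc k0) U" and W': "W' \<in> infl (Suc k0) W"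
      and meet: "interior (supp U') \<inter> interior (supp W') \<noteq> {}"
      and s: "supp U' \<subseteq> (*v) (matpow Q (Suc k0)) ` (interior (supp U) \<inter> interior (supp W))"
        "supp W' \<subseteq> (*v) (matpow Q (Suc k0)) ` (interior (supp U) \<inter> interior (supp W))"
      using k0[rule_format, OF le_SucI[OF order_refl]] by blast
    have d: "deep (Suc k0) U U'" "deep (Suc k0) W W'" unfolding deep_def using U' W' s by blast+
    have bad': "never_coincident U' W'" by (rule never_coincident_infl[OF bad U' W' meet])
    obtain k U2 W2 where 2: "U2 \<in> infl k U'" "W2 \<in> infl k W'"
      "interior (supp U2) \<inter> interior (supp W2) \<noteq> {}" "color U2 \<noteq> color W2"
      using never_coincident_reaches_two_colors[OF conn nonrod bad'] by blast
    have "(U2, W2) \<in> H" unfolding H_def using never_coincident_infl[OF bad' 2(1-3)] 2(4) by simp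
    moreover have "deep_step (Suc k0 + k) (U, W) (U2, W2)"
      unfolding deep_step_def using deep_infl[OF d(1) 2(1) t(1)] deep_infl[OF d(2) 2(2) t(2)] by simp
    moreover have "Suc k0 + k > 0" by simp
    ultimately show ?thesis by blast
  qed
  obtain U0 W0 where "never_coincident U0 W0" using never_coincident_exists[OF no_oc] by blast
  then obtain p0 where p0: "p0 \<in> H" using step by blast
  have "\<exists>f :: nat \<Rightarrow> _. \<forall>m. f m \<in> H \<and> (\<exists>k>0. deep_step k (f m) (f (Suc m)))"
  proof (rule dependent_nat_choice)
    show "\<exists>p. p \<in> H" using p0 by blast
    fix p and m :: nat assume "p \<in> H"
    then have "never_coincident (fst p) (snd p)" unfolding H_def by blast
    from step[OF this] show "\<exists>q. q \<in> H \<and> (\<exists>k>0. deep_step k p q)"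
      unfolding prod.collapse by blast
  qed
  then obtain f :: "nat \<Rightarrow> _" where f: "\<And>m. f m \<in> H" "\<And>m. \<exists>k>0. deep_step k (f m) (f (Suc m))"
    by blast
  have trans: "deep_step (k + l) p r" if "deep_step k p q" "deep_step l q r" "p \<in> H" for k l p q r
    using that deep_infl Ht[OF that(3)] unfolding deep_step_def deep_def[of l] by blast
  have far: "\<exists>k\<ge>Suc l. deep_step k (f a) (f (a + Suc l))" for a l
  proof (induction l)
    case 0
    obtain k where "k > 0" "deep_step k (f a) (f (Suc a))" using f(2)[of a] by blast
    then show ?case by (intro exI[of _ k]) simp
  next
    case (Suc l)
    then obtain k where k: "k \<ge> Suc l" "deep_step k (f a) (f (a + Suc l))" by blast
    obtain k' where k': "k' > 0" "deep_step k' (f (a + Suc l)) (f (Suc (a + Suc l)))"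
      using f(2)[of "a + Suc l"] by blast
    have "deep_step (k + k') (f a) (f (Suc (a + Suc l)))" by (rule trans[OF k(2) k'(2) f(1)])
    moreover have "k + k' \<ge> Suc (Suc l)" using k(1) k'(1) by simp
    ultimately show ?case by auto
  qed
  have pc: "pair_class (f m) \<in> {pair_class (U, W) | U W. overlap_pair U W}" for m
  proof -
    have "overlap_pair (fst (f m)) (snd (f m))" using f(1)[of m] unfolding H_def never_coincident_def by blast
    then have "pair_class (fst (f m), snd (f m)) \<in> {pair_class (U, W) | U W. overlap_pair U W}"
      by blast
    then show ?thesis unfolding prod.collapse .
  qed
  have "finite ((\<lambda>m. pair_class (f m)) ` UNIV)"
    by (rule finite_subset[OF _ finite_pair_classes]) (use pc in blast)
  then have "\<exists>a\<in>UNIV. infinite {b \<in> UNIV. pair_class (f b) = pair_class (f a)}"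
    by (intro pigeonhole_infinite) simp_all
  then obtain a where "infinite {b. pair_class (f b) = pair_class (f a)}" by auto
  then obtain b where b: "b > a + n0" "pair_class (f b) = pair_class (f a)"
    unfolding infinite_nat_iff_unbounded by blast
  define l where "l = b - a - 1"
  have l: "b = a + Suc l" "Suc l > n0" using b(1) by (simp_all add: l_def)
  obtain n where n: "n \<ge> Suc l" "deep_step n (f a) (f b)" using far[of l a] unfolding l(1) by blast
  obtain U W where UW: "f a = (U, W)" by (cases "f a")
  obtain U' W' where UW': "f b = (U', W')" by (cases "f b")
  have "pair_class (U, W) = pair_class (U', W')" using b(2) UW UW' by simp
  then obtain z where z: "U' = shift z U" "W' = shift z W"
    using pair_class_eqD[of U W U' W'] Ht[OF f(1)[of a]] Ht[OF f(1)[of b]] UW UW' by auto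
  have "never_coincident U W" "color U \<noteq> color W" using f(1)[of a] UW unfolding H_def by simp_all
  moreover have "deep n U (shift z U)" "deep n W (shift z W)"
    using n(2) UW UW' z unfolding deep_step_def by simp_all
  moreover have "n > n0" using n(1) l(2) by simp
  ultimately show ?thesis by blast
qed

section \<open>Control points\<close>

text \<open>
  A tile map is determined by its values on the prototiles.
\<close>

lemma tile_map_of_prototile_choice:
  assumes r: "\<And>e. deep n (prototile A e) (r e)"
  defines "\<gamma> \<equiv> \<lambda>T. shift (Qpow n (position T)) (r (color T))"
  shows "tile_map A Q D \<T> n \<gamma>" "\<And>T. T \<in> \<T> \<Longrightarrow> deep n T (\<gamma> T)"
proof -
  show deep: "deep n T (\<gamma> T)" if "T \<in> \<T>" for T
  proof -
    have "T \<in> tiles" using that tiling_subset_tiles by blast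
    then have "shift (position T) (prototile A (color T)) = T" by (rule shift_position)
    then show ?thesis
      using deep_shift[OF r[of "color T"], of "position T"] unfolding \<gamma>_def by simp
  qed
  show "tile_map A Q D \<T> n \<gamma>"
    unfolding tile_map_def infl_def[symmetric]
  proof (intro conjI ballI allI impI)
    fix T assume T: "T \<in> \<T>"
    show "\<gamma> T \<in> infl n T" using deep[OF T] unfolding deep_def by blast
    then show "\<gamma> T \<in> \<T>" by (rule infl_in_tiling[OF T])
  next
    fix T T' x assume T: "T \<in> \<T>" "T' = shift x T"
    then have "position T' = x + position T" using position_shift tiling_subset_tiles by blast
    then show "\<gamma> T' = shift (Qpow n x) (\<gamma> T)" unfolding \<gamma>_def by (simp add: T(2) Qpow_add)
  qed
qed

end

locale tile_map_level = fixed_substitution_tiling A Q D \<T>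
  for A :: "'c::finite \<Rightarrow> (real ^ 'd::finite) set"
    and Q :: "real ^ 'd ^ 'd"
    and D :: "'c \<Rightarrow> 'c \<Rightarrow> (real ^ 'd) set"
    and \<T> :: "('d, 'c) tile set" +
  fixes n :: nat and \<gamma> :: "('d, 'c) tile \<Rightarrow> ('d, 'c) tile"
  assumes level_pos: "n > 0" and tile_map: "tile_map A Q D \<T> n \<gamma>"
begin

abbreviation c :: "('d, 'c) tile \<Rightarrow> real ^ 'd" where
  "c \<equiv> control_point Q \<T> n \<gamma>"

lemma gamma_in_tiling: "T \<in> \<T> \<Longrightarrow> \<gamma> T \<in> \<T>"
  using tile_map unfolding tile_map_def by blast

lemma gamma_in_infl: "T \<in> \<T> \<Longrightarrow> \<gamma> T \<in> infl n T"
  using tile_map unfolding tile_map_def infl_def by blast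

lemma gamma_shift: "T \<in> \<T> \<Longrightarrow> shift x T \<in> \<T> \<Longrightarrow> \<gamma> (shift x T) = shift (Qpow n x) (\<gamma> T)"
  using tile_map unfolding tile_map_def by blast

lemma funpow_gamma_in_tiling: "T \<in> \<T> \<Longrightarrow> (\<gamma> ^^ k) T \<in> \<T>"
  by (induction k) (simp_all add: gamma_in_tiling)

lemma Qpow_mult_Suc: "Qpow (n * Suc k) x = Qpow n (Qpow (n * k) x)"
  unfolding mult_Suc_right by (rule matpow_add_vec)

lemma funpow_gamma_shift:
  assumes "T \<in> \<T>" "shift x T \<in> \<T>"
  shows "(\<gamma> ^^ k) (shift x T) = shift (Qpow (n * k) x) ((\<gamma> ^^ k) T)"
proof (induction k)
  case (Suc k)
  have "(\<gamma> ^^ Suc k) (shift x T) = \<gamma> (shift (Qpow (n * k) x) ((\<gamma> ^^ k) T))" using Suc by simp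
  also have "\<dots> = shift (Qpow n (Qpow (n * k) x)) (\<gamma> ((\<gamma> ^^ k) T))"
    using funpow_gamma_in_tiling[OF assms(2), of k] Suc
    by (intro gamma_shift funpow_gamma_in_tiling assms) simp
  also have "\<dots> = shift (Qpow (n * Suc k) x) ((\<gamma> ^^ Suc k) T)" unfolding Qpow_mult_Suc by simp
  finally show ?case .
qed simp

text \<open>
  The preimages of the supports form a decreasing sequence of compact sets. Two points of their
  intersection stay in common tiles under all powers \<open>Q\<^sup>n\<^sup>k\<close>, so their distance remains bounded; this
  is impossible for distinct points, as \<open>Q\<close> is expansive.
\<close>

lemma control_point_exists_unique:
  assumes T: "T \<in> \<T>"
  shows "\<exists>!x. x \<in> (\<Inter>k\<in>{1..}. (\<lambda>x. Qpow (n * k) x) -` supp ((\<gamma> ^^ k) T))"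
proof (rule ex_ex1I)
  define F where "F k = (\<lambda>x. Qpow (n * k) x) -` supp ((\<gamma> ^^ k) T)" for k
  have t: "(\<gamma> ^^ k) T \<in> tiles" for k using funpow_gamma_in_tiling[OF T] tiling_subset_tiles by blast
  have step: "F (Suc k) \<subseteq> F k" for k
  proof
    fix x assume "x \<in> F (Suc k)"
    then have "Qpow n (Qpow (n * k) x) \<in> supp (\<gamma> ((\<gamma> ^^ k) T))" unfolding F_def Qpow_mult_Suc by simp
    then have "Qpow n (Qpow (n * k) x) \<in> Qpow n ` supp ((\<gamma> ^^ k) T)"
      using infl_supp_subset[OF t gamma_in_infl[OF funpow_gamma_in_tiling[OF T]]] by blast
    then have "Qpow (n * k) x \<in> supp ((\<gamma> ^^ k) T)" unfolding inj_image_mem_iff[OF inj_Qpow] .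
    then show "x \<in> F k" unfolding F_def by simp
  qed
  have anti: "F l \<subseteq> F k" if "k \<le> l" for k l by (rule lift_Suc_antimono_le[of F, OF step that])
  have closed: "closed (F k)" for k
    unfolding F_def using tile_closed[OF t]
    by (intro continuous_closed_vimage linear_continuous_at matrix_vector_mul_bounded_linear)
  have "F 0 = supp T" unfolding F_def by (simp add: vimage_def)
  moreover have "T \<in> tiles" using T tiling_subset_tiles by blast
  ultimately have F0: "compact (F 0)" using tile_compact by simp
  have cpt: "compact (F k)" for k
    using compact_Int_closed[OF F0 closed[of k]] anti[of 0 k] by (simp add: Int_absorb1)
  have ne: "F k \<noteq> {}" for k
  proof -
    obtain p where p: "p \<in> supp ((\<gamma> ^^ k) T)" using tile_nonempty[OF t] by blast
    obtain x where "p = Qpow (n * k) x" using surj_Qpow by blast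
    then have "x \<in> F k" using p unfolding F_def by simp
    then show ?thesis by blast
  qed
  have "\<Inter> (range F) \<noteq> {}" by (rule compact_nest[OF cpt ne anti])
  then obtain x where "x \<in> \<Inter> (range F)" by blast
  then have "x \<in> (\<Inter>k\<in>{1..}. F k)" by blast
  then show "\<exists>x. x \<in> (\<Inter>k\<in>{1..}. (\<lambda>x. Qpow (n * k) x) -` supp ((\<gamma> ^^ k) T))"
    unfolding F_def by blast
next
  fix x y
  assume x: "x \<in> (\<Inter>k\<in>{1..}. (\<lambda>x. Qpow (n * k) x) -` supp ((\<gamma> ^^ k) T))"
    and y: "y \<in> (\<Inter>k\<in>{1..}. (\<lambda>x. Qpow (n * k) x) -` supp ((\<gamma> ^^ k) T))"
  obtain \<delta> where "\<delta> > 0" and \<delta>: "\<And>T x y. T \<in> tiles \<Longrightarrow> x \<in> supp T \<Longrightarrow> y \<in> supp T \<Longrightarrow> dist x y \<le> \<delta>"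
    using tile_diameter by blast
  show "x = y"
  proof (rule eq_if_bounded_orbit)
    fix k
    have "Qpow (n * Suc k) x \<in> supp ((\<gamma> ^^ Suc k) T)" "Qpow (n * Suc k) y \<in> supp ((\<gamma> ^^ Suc k) T)"
      using x y by (simp_all del: mult_Suc_right funpow.simps)
    then have "dist (Qpow (n * Suc k) x) (Qpow (n * Suc k) y) \<le> \<delta>"
      using \<delta> funpow_gamma_in_tiling[OF T] tiling_subset_tiles by blast
    then have "norm (Qpow (n * Suc k) (x - y)) \<le> \<delta>" unfolding Qpow_diff dist_norm .
    moreover have "n * Suc k \<ge> 1 * Suc k" using level_pos by (intro mult_right_mono) auto
    then have "n * Suc k \<ge> k" by simp
    ultimately show "\<exists>m\<ge>k. norm (Qpow m (x - y)) \<le> \<delta>" by blast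
  qed
qed

abbreviation cin :: "('d, 'c) tile \<Rightarrow> real ^ 'd" where
  "cin \<equiv> control_point_in Q n \<gamma>"

lemma cin_mem:
  assumes "T \<in> \<T>" "k \<ge> 1"
  shows "Qpow (n * k) (cin T) \<in> supp ((\<gamma> ^^ k) T)"
proof -
  have "cin T \<in> (\<Inter>k\<in>{1..}. (\<lambda>x. Qpow (n * k) x) -` supp ((\<gamma> ^^ k) T))"
    unfolding control_point_in_def by (rule theI'[OF control_point_exists_unique[OF assms(1)]])
  from INT_D[OF this, of k] show ?thesis using assms(2) by simp
qed

lemma cin_eqI:
  assumes "T \<in> \<T>" "\<And>k. k \<ge> 1 \<Longrightarrow> Qpow (n * k) x \<in> supp ((\<gamma> ^^ k) T)"
  shows "cin T = x"
  unfolding control_point_in_def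
  by (rule the1_equality[OF control_point_exists_unique[OF assms(1)]]) (use assms(2) in \<open>simp only: INT_iff vimage_eq atLeast_iff, blast\<close>)

lemma cin_shift:
  assumes "T \<in> \<T>" "shift x T \<in> \<T>"
  shows "cin (shift x T) = cin T + x"
proof (rule cin_eqI[OF assms(2)])
  fix k :: nat assume "k \<ge> 1"
  then have "Qpow (n * k) (cin T) \<in> supp ((\<gamma> ^^ k) T)" by (rule cin_mem[OF assms(1)])
  then have "Qpow (n * k) x + Qpow (n * k) (cin T) \<in> supp (shift (Qpow (n * k) x) ((\<gamma> ^^ k) T))"
    unfolding supp_shift by (rule imageI)
  then show "Qpow (n * k) (cin T + x) \<in> supp ((\<gamma> ^^ k) (shift x T))"
    unfolding funpow_gamma_shift[OF assms] Qpow_add by (simp only: add.commute)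
qed

lemma cin_gamma:
  assumes "T \<in> \<T>" shows "cin (\<gamma> T) = Qpow n (cin T)"
proof (rule cin_eqI[OF gamma_in_tiling[OF assms]])
  fix k :: nat
  have "Qpow (n * Suc k) (cin T) \<in> supp ((\<gamma> ^^ Suc k) T)" using cin_mem[OF assms, of "Suc k"] by simp
  moreover have "n * Suc k = n * k + n" by simp
  ultimately show "Qpow (n * k) (Qpow n (cin T)) \<in> supp ((\<gamma> ^^ k) (\<gamma> T))"
    unfolding funpow_Suc_right o_apply by (simp only: matpow_add_vec)
qed

lemma c_shift_tiling:
  assumes "T \<in> \<T>" shows "c (shift x T) = cin T + x"
  unfolding control_point_def
proof (rule the_equality)
  show "\<exists>T'\<in>\<T>. \<exists>x'. shift x T = shift x' T' \<and> cin T + x = cin T' + x'" using assms by blast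
next
  fix p assume "\<exists>T'\<in>\<T>. \<exists>x'. shift x T = shift x' T' \<and> p = cin T' + x'"
  then obtain T' x' where T': "T' \<in> \<T>" "shift x T = shift x' T'" "p = cin T' + x'" by blast
  have "shift (- x') (shift x T) = T'" unfolding T'(2) by simp
  then have eq: "T' = shift (x - x') T" by simp
  have "cin T' = cin T + (x - x')" unfolding eq by (rule cin_shift[OF assms]) (use T'(1) eq in simp)
  then show "p = cin T + x" unfolding T'(3) by simp
qed

lemma c_tiling: "T \<in> \<T> \<Longrightarrow> c T = cin T"
  using c_shift_tiling[of T 0] by simp

lemma c_shift:
  assumes "T \<in> tiles" shows "c (shift x T) = c T + x"
proof -
  obtain T0 where T0: "T0 \<in> \<T>" "color T0 = color T" using tile_of_color by blast
  then have t: "T0 \<in> tiles" using tiling_subset_tiles by blast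
  have T: "T = shift (position T - position T0) T0"
    by (rule tile_eqI) (simp_all add: assms t T0 position_shift)
  have a: "c T = cin T0 + (position T - position T0)"
    by (subst T) (rule c_shift_tiling[OF T0(1)])
  have "shift x T = shift (x + (position T - position T0)) T0" by (subst T) simp
  then have b: "c (shift x T) = cin T0 + (x + (position T - position T0))"
    using c_shift_tiling[OF T0(1)] by simp
  show ?thesis unfolding a b by (simp only: add.commute add.left_commute)
qed

text \<open>
  The equation that determines control points: with \<open>\<gamma> T = T + z\<close> it reads \<open>Q\<^sup>n x = x + z\<close>.
\<close>

lemma c_gamma: "T \<in> \<T> \<Longrightarrow> c (\<gamma> T) = Qpow n (c T)"
  using cin_gamma c_tiling gamma_in_tiling by simp

lemma Qpow_c_in_gamma: "T \<in> \<T> \<Longrightarrow> Qpow n (c T) \<in> supp (\<gamma> T)"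
  using cin_mem[of T 1] c_tiling by simp

lemma c_diff_same_color:
  assumes "S \<in> \<T>" "T \<in> \<T>" "color S = color T"
  shows "c S - c T = position S - position T"
proof -
  have "c (shift (position S - position T) T) = c T + (position S - position T)"
    using assms(2) tiling_subset_tiles by (intro c_shift) blast
  then show ?thesis using same_color_return_vec(2)[OF assms] by simp
qed

lemma diff_control_set:
  "diff_set (control_set \<T> c i) =
    {c S - c T | S T. S \<in> \<T> \<and> T \<in> \<T> \<and> color S = i \<and> color T = i}"
  unfolding diff_set_def control_set_def by blast

lemma diff_control_set_subset: "diff_set (control_set \<T> c i) \<subseteq> return_vecs"
proof
  fix z assume "z \<in> diff_set (control_set \<T> c i)"
  then obtain S T where "S \<in> \<T>" "T \<in> \<T>" "color S = color T" "z = c S - c T"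
    unfolding diff_control_set by auto
  then show "z \<in> return_vecs" using c_diff_same_color same_color_return_vec(1) by simp
qed

text \<open>
  The vector \<open>y\<close> translates one tile of \<open>\<T>\<close> to another, so \<open>Q\<^sup>k y\<close> translates one inflated tile to
  the other, and by primitivity a tile of color \<open>i\<close> in the first to one in the second. This makes
  the return module independent of the color.
\<close>

lemma return_vec_in_diff_control_set:
  assumes "y \<in> return_vecs"
  shows "\<exists>k. Qpow k y \<in> diff_set (control_set \<T> c i)"
proof -
  obtain U where U: "U \<in> \<T>" "shift y U \<in> \<T>" using assms return_vecs_iff by blast
  obtain K where "\<forall>k\<ge>K. \<forall>T\<in>tiles. \<forall>i. \<exists>S\<in>infl k T. color S = i"
    using all_colors_in_infl by (rule exE)
  then obtain S where S: "S \<in> infl K U" "color S = i" using U(1) tiling_subset_tiles by blast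
  have S\<T>: "S \<in> \<T>" by (rule infl_in_tiling[OF U(1) S(1)])
  have "shift (Qpow K y) S \<in> infl K (shift y U)" using S(1) by (simp add: infl_shift)
  then have S': "shift (Qpow K y) S \<in> \<T>" by (rule infl_in_tiling[OF U(2)])
  have "c (shift (Qpow K y) S) = c S + Qpow K y" using S\<T> tiling_subset_tiles by (intro c_shift) blast
  then have "Qpow K y = c (shift (Qpow K y) S) - c S" by simp
  then have "Qpow K y \<in> diff_set (control_set \<T> c i)"
    unfolding diff_control_set mem_Collect_eq using S' S\<T> S(2)
    by (intro exI[of _ "shift (Qpow K y) S"] exI[of _ S]) simp
  then show ?thesis ..
qed

lemma return_moduleI:
  assumes "Qpow k w \<in> return_vecs"
  shows "w \<in> return_module Q (control_set \<T> c)"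
proof -
  let ?i = "SOME i :: 'c. True"
  obtain l where "Qpow l (Qpow k w) \<in> diff_set (control_set \<T> c ?i)"
    using return_vec_in_diff_control_set[OF assms] by (rule exE)
  then have "w \<in> (\<lambda>x. Qpow (l + k) x) -` diff_set (control_set \<T> c ?i)"
    by (simp add: matpow_add_vec)
  then show ?thesis unfolding return_module_def Let_def by (intro group_closure.base) blast
qed

text \<open>
  The vectors that some power of \<open>Q\<close> maps to return vectors form a group if \<open>Q\<^sup>M\<close> maps
  differences of return vectors to return vectors.
\<close>

lemma return_moduleD:
  assumes sum: "\<And>x y. x \<in> return_vecs \<Longrightarrow> y \<in> return_vecs \<Longrightarrow> Qpow M (x - y) \<in> return_vecs"
    and "w \<in> return_module Q (control_set \<T> c)"
  shows "\<exists>k. Qpow k w \<in> return_vecs"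
  using assms(2) unfolding return_module_def Let_def
proof (induction rule: group_closure.induct)
  case (base s)
  show ?case
  proof (cases "s = 0")
    case True
    then show ?thesis using zero_return_vecs by (intro exI[of _ 0]) simp
  next
    case False
    then show ?thesis using base diff_control_set_subset by auto
  qed
next
  case (diff s t)
  then obtain k l where k: "Qpow k s \<in> return_vecs" and l: "Qpow l t \<in> return_vecs" by blast
  have s: "Qpow (k + l) s \<in> return_vecs" using return_vecs_Qpow[OF k, of l]
    by (simp add: add.commute[of k l] matpow_add_vec)
  have t: "Qpow (k + l) t \<in> return_vecs" using return_vecs_Qpow[OF l, of k] by (simp add: matpow_add_vec)
  have "Qpow (M + (k + l)) (s - t) \<in> return_vecs"
    using sum[OF s t] by (simp add: matpow_add_vec Qpow_diff)
  then show ?case ..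
qed

section \<open>Strong coincidence for admissible control points\<close>

lemma centered_prototile_eq:
  assumes "U \<in> \<T>"
  shows "centered_prototile A c (color U) = shift (- c U) U"
proof -
  have t: "U \<in> tiles" using assms tiling_subset_tiles by blast
  have U: "U = shift (position U) (prototile A (color U))" using shift_position[OF t] by simp
  have "c U = c (prototile A (color U)) + position U" by (subst U) (rule c_shift[OF prototile_tiles])
  moreover have "shift (- c U) U = shift (- c U + position U) (prototile A (color U))"
    by (subst (2) U) simp
  ultimately show ?thesis unfolding centered_prototile_def by simp
qed

text \<open>
  Move the tile \<open>V\<close> of color \<open>j\<close> by \<open>z\<close> so that its control point becomes that of the tile \<open>U\<close> of
  color \<open>i\<close>. By admissibility the two tiles overlap, but \<open>z\<close> need not be a return vector. It is in
  the return module, however, so \<open>Q\<^sup>k z\<close> is a return vector for some \<open>k\<close>, and the inflations of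
  level \<open>k\<close> contain a pair to which overlap coincidence applies.
\<close>

theorem strong_coincidence_if_overlap_coincidence:
  assumes oc: "\<And>U W. overlap_pair U W \<Longrightarrow> infl l U \<inter> infl l W \<noteq> {}"
    and l: "l > 0"
    and adm: "admissible A c"
    and module: "diff_set (\<Union>i. control_set \<T> c i) \<subseteq> return_module Q (control_set \<T> c)"
  shows "strong_coincidence A Q D c"
  unfolding strong_coincidence_def
proof (intro allI)
  fix i j
  obtain U where U: "U \<in> \<T>" "color U = i" using tile_of_color by blast
  obtain V where V: "V \<in> \<T>" "color V = j" using tile_of_color by blast
  have t: "U \<in> tiles" "V \<in> tiles" using U V tiling_subset_tiles by blast+
  define z where "z = c V - c U"
  define W where "W = shift (- z) V"
  have Wt: "W \<in> tiles" unfolding W_def using t by simp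
  have ci: "centered_prototile A c i = shift (- c U) U"
    using centered_prototile_eq[OF U(1)] U(2) by simp
  have cj: "centered_prototile A c j = shift (- c U) W"
    using centered_prototile_eq[OF V(1)] V(2) by (simp add: W_def z_def)
  have "z \<in> return_module Q (control_set \<T> c)"
  proof -
    have "c V \<in> (\<Union>i. control_set \<T> c i)" "c U \<in> (\<Union>i. control_set \<T> c i)"
      unfolding control_set_def using U(1) V(1) by blast+
    then show ?thesis unfolding z_def by (intro subsetD[OF module] diff_setI)
  qed
  moreover obtain M where M: "\<forall>x\<in>return_vecs. \<forall>y\<in>return_vecs. Qpow M (x - y) \<in> return_vecs"
    using Qpow_diff_return_vecs[OF oc] by (rule exE)
  ultimately have "\<exists>k. Qpow k z \<in> return_vecs" by (intro return_moduleD[of M]) (use M in blast)+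
  then obtain k where k: "Qpow k z \<in> return_vecs" by (rule exE)
  obtain p where p: "p \<in> interior (\<Inter>i. supp (centered_prototile A c i))"
    using adm unfolding admissible_def by blast
  have int: "p \<in> interior (supp (centered_prototile A c e))" for e
    by (rule subsetD[OF interior_mono p]) blast
  have "p \<in> (+) (- c U) ` interior (supp U)" using int[of i] unfolding ci interior_supp_shift .
  moreover have "p \<in> (+) (- c U) ` interior (supp W)" using int[of j] unfolding cj interior_supp_shift .
  ultimately have "interior (supp U) \<inter> interior (supp W) \<noteq> {}" by auto
  then obtain U' W' where U': "U' \<in> infl k U" and W': "W' \<in> infl k W"
    and meet: "interior (supp U') \<inter> interior (supp W') \<noteq> {}"
    using infl_interiors_meet[OF t(1) Wt] by blast
  have "shift (Qpow k z) W' \<in> infl k V" using W' by (simp add: W_def infl_shift_iff Qpow_minus)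
  then have "translated W'" unfolding translated_def using k infl_in_tiling[OF V(1)] by blast
  then have "overlap_pair U' W'"
    unfolding overlap_pair_def using meet infl_in_tiling[OF U(1) U'] by blast
  then obtain S where "S \<in> infl l U'" "S \<in> infl l W'" using oc by blast
  then have "S \<in> infl (k + l) U" "S \<in> infl (k + l) W" using U' W' infl_addI by blast+
  then have "shift (- Qpow (k + l) (c U)) S \<in>
      infl (k + l) (centered_prototile A c i) \<inter> infl (k + l) (centered_prototile A c j)"
    unfolding ci cj by (simp add: infl_shift_iff Qpow_minus)
  then have "infl (k + l) (centered_prototile A c i) \<inter> infl (k + l) (centered_prototile A c j) \<noteq> {}"
    by blast
  then show "\<exists>L>0. (Omega A Q D ^^ L) {centered_prototile A c i} \<inter>
      (Omega A Q D ^^ L) {centered_prototile A c j} \<noteq> {}"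
    unfolding infl_def using l by (intro exI[of _ "k + l"]) simp
qed

section \<open>Control points violating strong coincidence\<close>

lemma control_point_interior:
  assumes "T \<in> \<T>" "deep n T (\<gamma> T)"
  shows "c T \<in> interior (supp T)"
proof -
  have "Qpow n (c T) \<in> Qpow n ` interior (supp T)"
    using Qpow_c_in_gamma[OF assms(1)] assms(2) unfolding deep_def by blast
  then show ?thesis unfolding inj_image_mem_iff[OF inj_Qpow] .
qed

text \<open>
  All control points are interior points, so each centered prototile is a neighborhood of the origin.
\<close>

lemma admissible_if_deep:
  assumes "\<And>T. T \<in> \<T> \<Longrightarrow> deep n T (\<gamma> T)"
  shows "admissible A c"
proof -
  have 0: "0 \<in> interior (supp (centered_prototile A c e))" for e
  proof -
    obtain T where T: "T \<in> \<T>" "color T = e" using tile_of_color by blast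
    have "c T \<in> interior (supp T)" using control_point_interior assms T(1) by blast
    then have "0 \<in> (+) (- c T) ` interior (supp T)" by (rule image_eqI[rotated]) simp
    moreover have "centered_prototile A c e = shift (- c T) T"
      using centered_prototile_eq[OF T(1)] unfolding T(2) .
    ultimately show ?thesis by (simp only: interior_supp_shift)
  qed
  have "open (\<Inter>e. interior (supp (centered_prototile A c e)))" by (intro open_INT) auto
  moreover have "(\<Inter>e. interior (supp (centered_prototile A c e))) \<subseteq> (\<Inter>e. supp (centered_prototile A c e))"
    using interior_subset by blast
  ultimately have "(\<Inter>e. interior (supp (centered_prototile A c e))) \<subseteq>
      interior (\<Inter>e. supp (centered_prototile A c e))"
    by (rule interior_maximal[rotated])
  then show ?thesis unfolding admissible_def using 0 by blast
qed

lemma return_module_add: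
  "x \<in> return_module Q L \<Longrightarrow> y \<in> return_module Q L \<Longrightarrow> x + y \<in> return_module Q L"
  unfolding return_module_def Let_def by (rule group_closure_add)

lemma return_module_diff:
  "x \<in> return_module Q L \<Longrightarrow> y \<in> return_module Q L \<Longrightarrow> x - y \<in> return_module Q L"
  unfolding return_module_def Let_def by (rule group_closure.diff)

lemma same_color_in_module:
  assumes "S \<in> \<T>" "T \<in> \<T>" "color S = color T"
  shows "c S - c T \<in> return_module Q (control_set \<T> c)"
  by (rule return_moduleI[of 0])
    (use c_diff_same_color[OF assms] same_color_return_vec(1)[OF assms] in simp)

text \<open>
  A tile \<open>T\<close> of a color other than that of \<open>V\<close> is sent to a tile of the color of \<open>U\<close>. So \<open>Q\<^sup>n\<close> maps
  \<open>c T - c U\<close> to a difference of control points of equal color. The remaining color is connected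
  to \<open>U\<close> through \<open>V\<close>.
\<close>

lemma control_points_in_module:
  assumes U: "U \<in> \<T>" and V: "V \<in> \<T>" and UV: "c V - c U \<in> return_vecs"
    and col: "\<And>T. T \<in> \<T> \<Longrightarrow> color T \<noteq> color V \<Longrightarrow> color (\<gamma> T) = color U"
    and colU: "color U \<noteq> color V"
  shows "diff_set (\<Union>i. control_set \<T> c i) \<subseteq> return_module Q (control_set \<T> c)"
proof -
  have UV': "c V - c U \<in> return_module Q (control_set \<T> c)"
    by (rule return_moduleI[of 0]) (use UV in simp)
  have mod: "c T - c U \<in> return_module Q (control_set \<T> c)" if T: "T \<in> \<T>" for T
  proof (cases "color T = color V")
    case True
    have "(c T - c V) + (c V - c U) \<in> return_module Q (control_set \<T> c)"
      by (rule return_module_add[OF same_color_in_module[OF T V True] UV'])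
    then show ?thesis by simp
  next
    case False
    have eq: "color (\<gamma> T) = color (\<gamma> U)" using col[OF T False] col[OF U colU] by simp
    have \<gamma>: "\<gamma> T \<in> \<T>" "\<gamma> U \<in> \<T>" using gamma_in_tiling T U by blast+
    have "Qpow n (c T - c U) = position (\<gamma> T) - position (\<gamma> U)"
      unfolding Qpow_diff c_gamma[OF T, symmetric] c_gamma[OF U, symmetric]
      by (rule c_diff_same_color[OF \<gamma> eq])
    then have "Qpow n (c T - c U) \<in> return_vecs" using same_color_return_vec(1)[OF \<gamma> eq] by simp
    then show ?thesis by (rule return_moduleI)
  qed
  show ?thesis
  proof
    fix x assume "x \<in> diff_set (\<Union>i. control_set \<T> c i)"
    then obtain S T where ST: "S \<in> \<T>" "T \<in> \<T>" "x = c S - c T"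
      unfolding diff_set_def control_set_def by blast
    have "(c S - c U) - (c T - c U) \<in> return_module Q (control_set \<T> c)"
      by (rule return_module_diff[OF mod[OF ST(1)] mod[OF ST(2)]])
    then show "x \<in> return_module Q (control_set \<T> c)" unfolding ST(3) by simp
  qed
qed

lemma eq_0_if_Qpow_fixed:
  assumes "Qpow n w = w"
  shows "w = 0"
proof (rule eq_if_bounded_orbit)
  fix k
  have "Qpow (n * k) w = w"
    by (induction k) (simp_all add: assms Qpow_mult_Suc del: mult_Suc_right)
  moreover have "n * k \<ge> 1 * k" using level_pos by (intro mult_right_mono) auto
  ultimately show "\<exists>m\<ge>k. norm (Qpow m (w - 0)) \<le> norm w" by (intro exI[of _ "n * k"]) simp
qed

text \<open>
  The control points of \<open>U\<close> and \<open>W\<close> both solve \<open>Q\<^sup>n x = x + z\<close>, which has at most one solution. So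
  centering moves \<open>U\<close> and \<open>W\<close> by the same vector, and a common tile of the inflated centered
  prototiles yields one of the inflations of \<open>U\<close> and \<open>W\<close>.
\<close>

lemma no_strong_coincidence_if_never_coincident:
  assumes "never_coincident U W" "y \<in> return_vecs" "shift y W \<in> \<T>"
    and \<gamma>U: "\<gamma> U = shift z U" and \<gamma>V: "\<gamma> (shift y W) = shift (Qpow n y + z) W"
  shows "c (shift y W) - c U = y" "\<not> strong_coincidence A Q D c"
proof -
  have pair: "overlap_pair U W" using assms(1) unfolding never_coincident_def by blast
  have U: "U \<in> \<T>" using pair unfolding overlap_pair_def by blast
  have t: "U \<in> tiles" "W \<in> tiles" using overlap_pair_tiles[OF pair] .
  have cV: "c (shift y W) = c W + y" by (rule c_shift[OF t(2)])
  have "Qpow n (c U) = c U + z"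
    unfolding c_gamma[OF U, symmetric] \<gamma>U by (rule c_shift[OF t(1)])
  moreover have "Qpow n (c W + y) = c W + (Qpow n y + z)"
    unfolding cV[symmetric] c_gamma[OF assms(3), symmetric] \<gamma>V by (rule c_shift[OF t(2)])
  then have "Qpow n (c W) = c W + z" unfolding Qpow_add by (simp add: algebra_simps)
  ultimately have "Qpow n (c U - c W) = c U - c W" unfolding Qpow_diff by simp
  then have "c U - c W = 0" by (rule eq_0_if_Qpow_fixed)
  then have UW: "c W = c U" by simp
  show "c (shift y W) - c U = y" unfolding cV UW by simp
  show "\<not> strong_coincidence A Q D c"
  proof
    assume "strong_coincidence A Q D c"
    then obtain L where L: "infl L (centered_prototile A c (color U)) \<inter>
        infl L (centered_prototile A c (color (shift y W))) \<noteq> {}"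
      unfolding strong_coincidence_def infl_def by blast
    have "centered_prototile A c (color (shift y W)) = shift (- c U) W"
      unfolding centered_prototile_eq[OF assms(3)] cV UW by simp
    then have "infl L (shift (- c U) U) \<inter> infl L (shift (- c U) W) \<noteq> {}"
      using L unfolding centered_prototile_eq[OF U] by simp
    then have "infl L U \<inter> infl L W \<noteq> {}" by (rule coincidence_shift)
    then show False using assms(1) unfolding never_coincident_def by blast
  qed
qed

end

section \<open>Multiple strong coincidence and overlap coincidence\<close>

context fixed_substitution_tiling
begin

theorem multiple_strong_coincidence_if_overlap_coincidence:
  assumes "overlap_coincidence A Q D \<T>" "n > 0"
  shows "multiple_strong_coincidence A Q D \<T> n"
proof -
  obtain l where l: "l > 0" "\<And>U W. overlap_pair U W \<Longrightarrow> infl l U \<inter> infl l W \<noteq> {}"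
    using assms(1) unfolding overlap_coincidence_iff by blast
  show ?thesis
    unfolding multiple_strong_coincidence_def Let_def
  proof (intro allI impI, elim conjE)
    fix \<gamma> assume tm: "tile_map A Q D \<T> n \<gamma>"
    interpret tile_map_level A Q D \<T> n \<gamma> by unfold_locales (use assms(2) tm in auto)
    assume adm: "admissible A c"
      and module: "diff_set (\<Union>i. control_set \<T> c i) \<subseteq> return_module Q (control_set \<T> c)"
    show "strong_coincidence A Q D c"
    proof (rule strong_coincidence_if_overlap_coincidence[OF _ l(1) adm module])
      show "infl l U \<inter> infl l W \<noteq> {}" if "overlap_pair U W" for U W by (rule l(2)[OF that])
    qed
  qed
qed

text \<open>
  The tile map is taken from a recurrent pair of two colors: it sends \<open>U\<close> to \<open>U + z\<close> and the tile
  \<open>W + y\<close> of \<open>\<T>\<close> to \<open>W + z + Q\<^sup>n y\<close>. The tiles of all other colors are sent to deep tiles of the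
  color of \<open>U\<close>, which exist as soon as the level is large.
\<close>

theorem level_violating_multiple_strong_coincidence:
  assumes conn: "\<forall>T\<in>\<T>. connected (supp T)" and nonrod: "\<not> rod_tiling \<T>"
    and no_oc: "\<not> overlap_coincidence A Q D \<T>"
  shows "\<exists>n>0. \<not> multiple_strong_coincidence A Q D \<T> n"
proof -
  obtain k0 where k0: "\<forall>k\<ge>k0. \<forall>e i. \<exists>S. deep k (prototile A e) S \<and> color S = i"
    using deep_tile_of_color by (rule exE)
  obtain n U W z where n: "n > k0" and bad: "never_coincident U W" and col: "color U \<noteq> color W"
    and dU: "deep n U (shift z U)" and dW: "deep n W (shift z W)"
    using recurrent_never_coincident_pair[OF conn nonrod no_oc, of k0] by blast
  have n0: "n > 0" using n by simp
  have pair: "overlap_pair U W" using bad unfolding never_coincident_def by blast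
  have t: "U \<in> tiles" "W \<in> tiles" using overlap_pair_tiles[OF pair] .
  have U: "U \<in> \<T>" using pair unfolding overlap_pair_def by blast
  obtain y where y: "y \<in> return_vecs" "shift y W \<in> \<T>"
    using pair unfolding overlap_pair_def translated_def by blast
  have "\<forall>e. \<exists>S. deep n (prototile A e) S \<and> color S = color U" using k0 n by simp
  from choice[OF this] obtain r0 where
    r0: "\<forall>e. deep n (prototile A e) (r0 e) \<and> color (r0 e) = color U" by (rule exE)
  have proto: "deep n (prototile A (color T)) (shift (- Qpow n (position T)) S)"
    if "deep n T S" "T \<in> tiles" for T S
  proof -
    have "shift (- position T) T = prototile A (color T)"
      using shift_position[OF that(2)] shift_minus_eq_iff by metis
    then show ?thesis using deep_shift[OF that(1), of "- position T"] by (simp add: Qpow_minus)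
  qed
  \<comment> \<open>The values on the prototiles: those of \<open>U\<close> and \<open>W\<close>, moved back to the prototiles of their
    colors.\<close>
  define r where "r = r0(color U := shift (- Qpow n (position U)) (shift z U),
    color W := shift (- Qpow n (position W)) (shift z W))"
  have r: "deep n (prototile A e) (r e)" for e
    using r0 proto[OF dU t(1)] proto[OF dW t(2)] unfolding r_def by (simp add: fun_upd_def)
  define \<gamma> where "\<gamma> = (\<lambda>T. shift (Qpow n (position T)) (r (color T)))"
  have tm: "tile_map A Q D \<T> n \<gamma>" and deep: "\<And>T. T \<in> \<T> \<Longrightarrow> deep n T (\<gamma> T)"
    unfolding \<gamma>_def using tile_map_of_prototile_choice[of n r] r by blast+
  interpret tile_map_level A Q D \<T> n \<gamma> by unfold_locales (use n0 tm in auto)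
  have \<gamma>U: "\<gamma> U = shift z U" unfolding \<gamma>_def r_def using col by simp
  have \<gamma>V: "\<gamma> (shift y W) = shift (Qpow n y + z) W"
    unfolding \<gamma>_def r_def by (simp add: position_shift[OF t(2)] Qpow_add)
  have \<gamma>c: "color (\<gamma> T) = color U" if "color T \<noteq> color (shift y W)" for T
    using that r0 unfolding \<gamma>_def r_def by simp
  have "\<not> strong_coincidence A Q D c" and UV: "c (shift y W) - c U = y"
    using no_strong_coincidence_if_never_coincident[OF bad y \<gamma>U \<gamma>V] by blast+
  moreover have "admissible A c" by (rule admissible_if_deep[OF deep])
  moreover have "diff_set (\<Union>i. control_set \<T> c i) \<subseteq> return_module Q (control_set \<T> c)"
    by (rule control_points_in_module[OF U y(2)]) (use UV y(1) \<gamma>c col in simp_all)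
  ultimately have "\<not> multiple_strong_coincidence A Q D \<T> n"
    unfolding multiple_strong_coincidence_def Let_def using tm by blast
  then show ?thesis using n0 by blast
qed

end

theorem theorem3p2:
  fixes A :: "'c::finite \<Rightarrow> (real ^ 'd::finite) set"
    and Q :: "real ^ 'd ^ 'd"
    and D :: "'c \<Rightarrow> 'c \<Rightarrow> (real ^ 'd) set"
    and \<T> :: "('d, 'c) tile set"
  assumes "self_affine_tiling A Q D \<T>"
    and "Omega A Q D \<T> = \<T>"
    and "\<not> rod_tiling \<T>"
    and "\<forall>T\<in>\<T>. connected (supp T)"
    and "meyer (return_vectors \<T>)"
  shows "\<exists>n>0. multiple_strong_coincidence A Q D \<T> n \<longleftrightarrow> overlap_coincidence A Q D \<T>"
proof -
  interpret fixed_substitution_tiling A Q D \<T>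
    using assms(1,2,5) unfolding self_affine_tiling_def by unfold_locales blast+
  show ?thesis
  proof (cases "overlap_coincidence A Q D \<T>")
    case True
    then have "multiple_strong_coincidence A Q D \<T> 1"
      by (rule multiple_strong_coincidence_if_overlap_coincidence) simp
    with True show ?thesis by (intro exI[of _ 1]) simp
  next
    case False
    then show ?thesis
      using level_violating_multiple_strong_coincidence[OF assms(4,3)] by blast
  qed
qed

end
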